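(* Let $\delta:\mathcal G\to W$ be a strict $W$-groupoid of type $M$, let $\mathcal W(\mathcal G)$ be its associated Weyl data (which is a Weyl graph), and let $\delta':\overline{\mathcal W(\mathcal G)}\to W$ be the metrization of the fundamental groupoid of $\mathcal W(\mathcal G)$. Then there exists an isomorphism of groupoids $\psi:\mathcal G\to\overline{\mathcal W(\mathcal G)}$ such that $\delta=\delta'\circ\psi$.
   Context: Setting. $M=(m_{st})_{s,t\in S}$ is a Coxeter matrix on a finite set $S$, and $W=\langle S\mid (st)^{m_{st}}=1,\ m_{st}<\infty\rangle$ is its Coxeter group. A word over $S$ is reduced if no shorter word represents the same element of $W$. For $s\ne t$ let $p_m(s,t)=stst\cdots$ ($m$ letters), and if $m_{st}<\infty$ let $p(s,t)=p_{m_{st}}(s,t)$. Bruhat order on $W$: $u\le w$ if some reduced word for $w$ has a (not necessarily consecutive) subsequence which is a word for $u$. Groupoids are small and non-empty, with composition $g;h$ (or $gh$) written left to right, defined when $\tau(g)=\iota(h)$, where $\iota,\tau$ denote initial and terminal vertices. Weyl data. A generalized chamber system $\mathcal W$ of type $M$ is a set $\mathcal W_0$ of chambers with a family of groupoids $(\mathcal W_s)_{s\in S}$ (panel groupoids), each with vertex set $\mathcal W_0$. An edge of $\mathcal W$ of type $s$ is a non-identity edge of $\mathcal W_s$ (edges of different types are distinct). An $s$-panel is a connected component of $\mathcal W_s$. A gallery $\beta$ is a finite sequence of consecutive edges (a trivial gallery is a single chamber with no edges), with initial chamber $\iota(\beta)$, terminal chamber $\tau(\beta)$, type $\beta_S$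 (the word of types of its edges), and $W$-length $\beta_W\in W$ (the element represented by $\beta_S$). It is a cycle if $\iota(\beta)=\tau(\beta)$, and a geodesic if $\beta_S$ is reduced. For $s\neq t$ with $m_{st}<\infty$: a maximal $(s,t)$-geodesic is a gallery of type $p(s,t)$; an $(s,t)$-cycle is a cycle of type $p_{2m_{st}}(s,t)$. Weyl data of type $M$ is a generalized chamber system of type $M$ together with, for each ordered pair $(s,t)$ with $s\neq t$, $m_{st}<\infty$, a set of $(s,t)$-cycles called defining suites. Homotopy. Elementary homotopies of galleries are the following moves on subgalleries and their inverses: delete $i\,i^{-1}$; replace $i\,i'$ ($i,i'$ of the same type, $i'\ne i^{-1}$) by the single edge $i;i'$; delete a defining suite. Galleries are homotopic ($\sim$) if related by finitely many such moves. The fundamental groupoid $\overline{\mathcal W}$ has vertices the chambers and edges the homotopy classes $[\beta]$ of galleries, with $[\beta];[\beta']=[\beta\beta']$. A pre-Weyl graph is Weyl data satisfying (PW0) no panel is a trivial groupoid (one vertex, one edge), and (PW1) each maximal $(s,t)$-geodesic is homotopic to a maximal $(t,s)$-geodesic. A Weyl graph is a pre-Weyl graph satisfying (W) homotopic geodesics have the same $W$-length. In a pre-Weyl graph every homotopy class of galleries contains a geodesic; for a Weyl graph the metrization is the well-defined function from the edges of $\overline{\mathcal W}$ to $W$ sending $[\gamma]$ to $\gamma_W$ for geodesics $\gamma$. $W$-groupoids. A $W$-groupoid (of type $M$) on a groupoid $\mathcal G$ is a function $\delta$ from the edges of $\mathcal G$ to $W$ such that: (weak) for every vertex $C$ and every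 $s\in S$ there is an edge $g$ with $\iota(g)=C$ and $\delta(g)=s$; (WG1) $\delta(1)=1$ for all identity edges; (WG2) $\delta(gh)\ge\delta(g)\delta(h)$ in the Bruhat order whenever $gh$ is defined; (WG3) for every edge $g$ and $s\in S$ with $\delta(g)s<\delta(g)$ there is an edge $h$ with $\iota(h)=\iota(g)$, $\delta(h^{-1}g)=s$ and $\delta(h)=\delta(g)s$. It is strict if in addition $\delta(g)=1$ implies that $g$ is an identity edge. Associated Weyl data. For a strict $W$-groupoid $\delta:\mathcal G\to W$ and $s\in S$, the parabolic groupoid $\mathcal G_s$ is the subgroupoid of $\mathcal G$ with all vertices and with edges $\{g:\delta(g)\in\{1,s\}\}$. $\mathcal W(\mathcal G)$ is the Weyl data of type $M$ with chambers the vertices of $\mathcal G$, panel groupoids $(\mathcal G_s)_{s\in S}$, and defining suites all $(s,t)$-cycles ($s\ne t$, $m_{st}<\infty$) whose sequence of edges composes in $\mathcal G$ to an identity edge. *)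

theory Defs
  imports
    "HOL-Algebra.Group"
    "HOL-Library.Extended_Nat"
    "HOL-Library.Sublist"
begin

section \<open>Groups given by generators and relators\<close>

text \<open>
  A letter \<open>(x, True)\<close> stands for the generator \<open>x\<close>, and \<open>(x, False)\<close> for its formal inverse.
\<close>

type_synonym 'x signed_word = "('x \<times> bool) list"

abbreviation signed_words :: "'x set \<Rightarrow> 'x signed_word set" where
  "signed_words X \<equiv> lists (X \<times> UNIV)"

inductive presentation_step ::
    "'x set \<Rightarrow> 'x signed_word set \<Rightarrow> 'x signed_word \<Rightarrow> 'x signed_word \<Rightarrow> bool"
  for X :: "'x set" and R :: "'x signed_word set" where
  cancel: "u \<in> signed_words X \<Longrightarrow> v \<in> signed_words X \<Longrightarrow> x \<in> X \<Longrightarrow>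
    presentation_step X R (u @ [(x, b), (x, \<not> b)] @ v) (u @ v)"
| relator: "u \<in> signed_words X \<Longrightarrow> v \<in> signed_words X \<Longrightarrow> r \<in> R \<Longrightarrow> r \<in> signed_words X \<Longrightarrow>
    presentation_step X R (u @ r @ v) (u @ v)"

definition presentation_rel ::
    "'x set \<Rightarrow> 'x signed_word set \<Rightarrow> ('x signed_word \<times> 'x signed_word) set" where
  "presentation_rel X R =
    {(u, v). u \<in> signed_words X \<and> v \<in> signed_words X \<and> equivclp (presentation_step X R) u v}"

definition presented_group :: "'x set \<Rightarrow> 'x signed_word set \<Rightarrow> 'x signed_word set monoid" where
  "presented_group X R =
    \<lparr>carrier = signed_words X // presentation_rel X R,
     mult = (\<lambda>A B. \<Union>a\<in>A. \<Union>b\<in>B. presentation_rel X R `` {a @ b}),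
     one = presentation_rel X R `` {[]}\<rparr>"


section \<open>Coxeter groups\<close>

record 's coxeter_matrix =
  gens :: "'s set"
  cox :: "'s \<Rightarrow> 's \<Rightarrow> enat"

locale coxeter_matrix =
  fixes M :: "'s coxeter_matrix"
  assumes finite_gens: "finite (gens M)"
    and cox_diag: "s \<in> gens M \<Longrightarrow> cox M s s = 1"
    and cox_sym: "s \<in> gens M \<Longrightarrow> t \<in> gens M \<Longrightarrow> cox M s t = cox M t s"
    and cox_offdiag: "s \<in> gens M \<Longrightarrow> t \<in> gens M \<Longrightarrow> s \<noteq> t \<Longrightarrow> 2 \<le> cox M s t"

text \<open>The relator for \<open>s = t\<close> makes every generator an involution.\<close>

definition coxeter_relators :: "'s coxeter_matrix \<Rightarrow> 's signed_word set" where
  "coxeter_relators M =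
    {concat (replicate n [(s, True), (t, True)]) | s t n.
       s \<in> gens M \<and> t \<in> gens M \<and> cox M s t = enat n}"

definition coxeter_group :: "'s coxeter_matrix \<Rightarrow> 's signed_word set monoid" where
  "coxeter_group M = presented_group (gens M) (coxeter_relators M)"

text \<open>The element of the Coxeter group represented by a word over the generating set.\<close>

definition word_elt :: "'s coxeter_matrix \<Rightarrow> 's list \<Rightarrow> 's signed_word set" where
  "word_elt M w = presentation_rel (gens M) (coxeter_relators M) `` {map (\<lambda>s. (s, True)) w}"

abbreviation gen_elt :: "'s coxeter_matrix \<Rightarrow> 's \<Rightarrow> 's signed_word set" where
  "gen_elt M s \<equiv> word_elt M [s]"

definition reduced :: "'s coxeter_matrix \<Rightarrow> 's list \<Rightarrow> bool" where
  "reduced M w \<longleftrightarrow> w \<in> lists (gens M) \<and>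
    \<not> (\<exists>v \<in> lists (gens M). length v < length w \<and> word_elt M v = word_elt M w)"

definition bruhat_le ::
    "'s coxeter_matrix \<Rightarrow> 's signed_word set \<Rightarrow> 's signed_word set \<Rightarrow> bool" where
  "bruhat_le M u w \<longleftrightarrow>
    (\<exists>x y. reduced M x \<and> word_elt M x = w \<and> subseq y x \<and> word_elt M y = u)"

definition bruhat_less ::
    "'s coxeter_matrix \<Rightarrow> 's signed_word set \<Rightarrow> 's signed_word set \<Rightarrow> bool" where
  "bruhat_less M u w \<longleftrightarrow> bruhat_le M u w \<and> u \<noteq> w"

text \<open>The word \<open>stst...\<close> with \<open>n\<close> letters.\<close>

primrec alt_word :: "nat \<Rightarrow> 's \<Rightarrow> 's \<Rightarrow> 's list" where
  "alt_word 0 s t = []"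
| "alt_word (Suc n) s t = s # alt_word n t s"

definition finite_pairs :: "'s coxeter_matrix \<Rightarrow> ('s \<times> 's) set" where
  "finite_pairs M = {(s, t). s \<in> gens M \<and> t \<in> gens M \<and> s \<noteq> t \<and> cox M s t < \<infinity>}"


section \<open>Groupoids\<close>

text \<open>Composition is written from left to right.\<close>

record ('v, 'e) groupoid =
  verts :: "'v set"
  edges :: "'e set"
  ini :: "'e \<Rightarrow> 'v"
  ter :: "'e \<Rightarrow> 'v"
  idn :: "'v \<Rightarrow> 'e"
  cmp :: "'e \<Rightarrow> 'e \<Rightarrow> 'e"

definition is_inverse :: "('v, 'e) groupoid \<Rightarrow> 'e \<Rightarrow> 'e \<Rightarrow> bool" where
  "is_inverse G g h \<longleftrightarrow> h \<in> edges G \<and> ini G h = ter G g \<and> ter G h = ini G g \<and>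
    cmp G g h = idn G (ini G g) \<and> cmp G h g = idn G (ter G g)"

definition inverse_edge :: "('v, 'e) groupoid \<Rightarrow> 'e \<Rightarrow> 'e" where
  "inverse_edge G g = (THE h. is_inverse G g h)"

locale groupoid =
  fixes G :: "('v, 'e) groupoid"
  assumes nonempty: "verts G \<noteq> {}"
    and ini_closed: "g \<in> edges G \<Longrightarrow> ini G g \<in> verts G"
    and ter_closed: "g \<in> edges G \<Longrightarrow> ter G g \<in> verts G"
    and idn_closed: "C \<in> verts G \<Longrightarrow> idn G C \<in> edges G"
    and ini_idn: "C \<in> verts G \<Longrightarrow> ini G (idn G C) = C"
    and ter_idn: "C \<in> verts G \<Longrightarrow> ter G (idn G C) = C"
    and cmp_closed: "g \<in> edges G \<Longrightarrow> h \<in> edges G \<Longrightarrow> ter G g = ini G h \<Longrightarrow> cmp G g h \<in> edges G"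
    and ini_cmp: "g \<in> edges G \<Longrightarrow> h \<in> edges G \<Longrightarrow> ter G g = ini G h \<Longrightarrow>
      ini G (cmp G g h) = ini G g"
    and ter_cmp: "g \<in> edges G \<Longrightarrow> h \<in> edges G \<Longrightarrow> ter G g = ini G h \<Longrightarrow>
      ter G (cmp G g h) = ter G h"
    and idn_cmp: "g \<in> edges G \<Longrightarrow> cmp G (idn G (ini G g)) g = g"
    and cmp_idn: "g \<in> edges G \<Longrightarrow> cmp G g (idn G (ter G g)) = g"
    and cmp_assoc: "g \<in> edges G \<Longrightarrow> h \<in> edges G \<Longrightarrow> k \<in> edges G \<Longrightarrow>
      ter G g = ini G h \<Longrightarrow> ter G h = ini G k \<Longrightarrow>
      cmp G (cmp G g h) k = cmp G g (cmp G h k)"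
    and inverse_ex: "g \<in> edges G \<Longrightarrow> \<exists>h. is_inverse G g h"

definition trivial_groupoid :: "('v, 'e) groupoid \<Rightarrow> bool" where
  "trivial_groupoid G \<longleftrightarrow> (\<exists>C e. verts G = {C} \<and> edges G = {e})"

definition component :: "('v, 'e) groupoid \<Rightarrow> 'v \<Rightarrow> ('v, 'e) groupoid" where
  "component G C =
    (let V = {D \<in> verts G. \<exists>g \<in> edges G. ini G g = C \<and> ter G g = D}
     in G\<lparr>verts := V, edges := {g \<in> edges G. ini G g \<in> V \<and> ter G g \<in> V}\<rparr>)"

definition groupoid_iso ::
    "('v, 'e) groupoid \<Rightarrow> ('w, 'f) groupoid \<Rightarrow> ('v \<Rightarrow> 'w) \<Rightarrow> ('e \<Rightarrow> 'f) \<Rightarrow> bool" where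
  "groupoid_iso G H \<psi>\<^sub>0 \<psi> \<longleftrightarrow> groupoid G \<and> groupoid H \<and>
    bij_betw \<psi>\<^sub>0 (verts G) (verts H) \<and> bij_betw \<psi> (edges G) (edges H) \<and>
    (\<forall>g \<in> edges G. ini H (\<psi> g) = \<psi>\<^sub>0 (ini G g) \<and> ter H (\<psi> g) = \<psi>\<^sub>0 (ter G g)) \<and>
    (\<forall>C \<in> verts G. \<psi> (idn G C) = idn H (\<psi>\<^sub>0 C)) \<and>
    (\<forall>g \<in> edges G. \<forall>h \<in> edges G. ter G g = ini G h \<longrightarrow>
       \<psi> (cmp G g h) = cmp H (\<psi> g) (\<psi> h))"


section \<open>Generalized chamber systems and galleries\<close>

record ('s, 'v, 'e) chamber_system =
  chambers :: "'v set"
  panel_gpd :: "'s \<Rightarrow> ('v, 'e) groupoid"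

locale chamber_system =
  fixes M :: "'s coxeter_matrix" and W :: "('s, 'v, 'e, 'z) chamber_system_scheme"
  assumes panel_groupoid: "s \<in> gens M \<Longrightarrow> groupoid (panel_gpd W s)"
    and panel_verts: "s \<in> gens M \<Longrightarrow> verts (panel_gpd W s) = chambers W"

text \<open>
  An edge of type \<open>s\<close> is a pair \<open>(s, e)\<close> with \<open>e\<close> a non-identity edge of the panel groupoid of
  type \<open>s\<close>, so edges of different types are distinct. A gallery is an initial chamber
  together with a list of edges.
\<close>

type_synonym ('s, 'v, 'e) gallery = "'v \<times> ('s \<times> 'e) list"

fun is_path :: "'s coxeter_matrix \<Rightarrow> ('s, 'v, 'e, 'z) chamber_system_scheme \<Rightarrow>
    'v \<Rightarrow> ('s \<times> 'e) list \<Rightarrow> bool" where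
  "is_path M W C [] \<longleftrightarrow> C \<in> chambers W"
| "is_path M W C ((s, e) # xs) \<longleftrightarrow> C \<in> chambers W \<and> s \<in> gens M \<and>
    e \<in> edges (panel_gpd W s) \<and> ini (panel_gpd W s) e = C \<and> e \<noteq> idn (panel_gpd W s) C \<and>
    is_path M W (ter (panel_gpd W s) e) xs"

fun path_end :: "('s, 'v, 'e, 'z) chamber_system_scheme \<Rightarrow> 'v \<Rightarrow> ('s \<times> 'e) list \<Rightarrow> 'v" where
  "path_end W C [] = C"
| "path_end W C ((s, e) # xs) = path_end W (ter (panel_gpd W s) e) xs"

definition galleries ::
    "'s coxeter_matrix \<Rightarrow> ('s, 'v, 'e, 'z) chamber_system_scheme \<Rightarrow> ('s, 'v, 'e) gallery set" where
  "galleries M W = {\<beta>. is_path M W (fst \<beta>) (snd \<beta>)}"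

definition gal_ini :: "('s, 'v, 'e) gallery \<Rightarrow> 'v" where
  "gal_ini \<beta> = fst \<beta>"

definition gal_ter :: "('s, 'v, 'e, 'z) chamber_system_scheme \<Rightarrow> ('s, 'v, 'e) gallery \<Rightarrow> 'v" where
  "gal_ter W \<beta> = path_end W (fst \<beta>) (snd \<beta>)"

definition gal_append ::
    "('s, 'v, 'e) gallery \<Rightarrow> ('s, 'v, 'e) gallery \<Rightarrow> ('s, 'v, 'e) gallery" where
  "gal_append \<beta> \<beta>' = (fst \<beta>, snd \<beta> @ snd \<beta>')"

definition gal_type :: "('s, 'v, 'e) gallery \<Rightarrow> 's list" where
  "gal_type \<beta> = map fst (snd \<beta>)"

definition W_length :: "'s coxeter_matrix \<Rightarrow> ('s, 'v, 'e) gallery \<Rightarrow> 's signed_word set" where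
  "W_length M \<beta> = word_elt M (gal_type \<beta>)"

definition geodesics ::
    "'s coxeter_matrix \<Rightarrow> ('s, 'v, 'e, 'z) chamber_system_scheme \<Rightarrow> ('s, 'v, 'e) gallery set" where
  "geodesics M W = {\<gamma> \<in> galleries M W. reduced M (gal_type \<gamma>)}"

definition max_geodesics ::
    "'s coxeter_matrix \<Rightarrow> ('s, 'v, 'e, 'z) chamber_system_scheme \<Rightarrow> 's \<Rightarrow> 's \<Rightarrow>
     ('s, 'v, 'e) gallery set" where
  "max_geodesics M W s t =
    {\<gamma> \<in> galleries M W. gal_type \<gamma> = alt_word (the_enat (cox M s t)) s t}"

definition st_cycles ::
    "'s coxeter_matrix \<Rightarrow> ('s, 'v, 'e, 'z) chamber_system_scheme \<Rightarrow> 's \<Rightarrow> 's \<Rightarrow>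
     ('s, 'v, 'e) gallery set" where
  "st_cycles M W s t =
    {\<beta> \<in> galleries M W. gal_ini \<beta> = gal_ter W \<beta> \<and>
       gal_type \<beta> = alt_word (2 * the_enat (cox M s t)) s t}"

definition panels :: "('s, 'v, 'e, 'z) chamber_system_scheme \<Rightarrow> 's \<Rightarrow> ('v, 'e) groupoid set" where
  "panels W s = component (panel_gpd W s) ` chambers W"


section \<open>Weyl data, homotopy and the fundamental groupoid\<close>

record ('s, 'v, 'e) weyl_data = "('s, 'v, 'e) chamber_system" +
  suites :: "'s \<Rightarrow> 's \<Rightarrow> ('s, 'v, 'e) gallery set"

locale weyl_data = chamber_system M W
  for M :: "'s coxeter_matrix" and W :: "('s, 'v, 'e) weyl_data" +
  assumes suites_cycles: "(s, t) \<in> finite_pairs M \<Longrightarrow> suites W s t \<subseteq> st_cycles M W s t"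

inductive elementary_homotopy ::
    "'s coxeter_matrix \<Rightarrow> ('s, 'v, 'e) weyl_data \<Rightarrow>
     ('s, 'v, 'e) gallery \<Rightarrow> ('s, 'v, 'e) gallery \<Rightarrow> bool"
  for M :: "'s coxeter_matrix" and W :: "('s, 'v, 'e) weyl_data" where
  delete_inverse: "(C, us @ [(s, i), (s, inverse_edge (panel_gpd W s) i)] @ vs) \<in> galleries M W \<Longrightarrow>
    elementary_homotopy M W
      (C, us @ [(s, i), (s, inverse_edge (panel_gpd W s) i)] @ vs) (C, us @ vs)"
| compose: "(C, us @ [(s, i), (s, j)] @ vs) \<in> galleries M W \<Longrightarrow>
    j \<noteq> inverse_edge (panel_gpd W s) i \<Longrightarrow>
    elementary_homotopy M W
      (C, us @ [(s, i), (s, j)] @ vs) (C, us @ [(s, cmp (panel_gpd W s) i j)] @ vs)"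
| delete_suite: "(C, us @ xs @ vs) \<in> galleries M W \<Longrightarrow> (s, t) \<in> finite_pairs M \<Longrightarrow>
    (gal_ter W (C, us), xs) \<in> suites W s t \<Longrightarrow>
    elementary_homotopy M W (C, us @ xs @ vs) (C, us @ vs)"

definition homotopy_rel ::
    "'s coxeter_matrix \<Rightarrow> ('s, 'v, 'e) weyl_data \<Rightarrow>
     (('s, 'v, 'e) gallery \<times> ('s, 'v, 'e) gallery) set" where
  "homotopy_rel M W = {(\<beta>, \<beta>'). \<beta> \<in> galleries M W \<and> \<beta>' \<in> galleries M W \<and>
     equivclp (elementary_homotopy M W) \<beta> \<beta>'}"

definition homotopy_class ::
    "'s coxeter_matrix \<Rightarrow> ('s, 'v, 'e) weyl_data \<Rightarrow>
     ('s, 'v, 'e) gallery \<Rightarrow> ('s, 'v, 'e) gallery set" where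
  "homotopy_class M W \<beta> = homotopy_rel M W `` {\<beta>}"

text \<open>
  Homotopic galleries have the same end points, so the images under \<^const>\<open>the_elem\<close> below are
  singletons for every homotopy class.
\<close>

definition fundamental_groupoid ::
    "'s coxeter_matrix \<Rightarrow> ('s, 'v, 'e) weyl_data \<Rightarrow> ('v, ('s, 'v, 'e) gallery set) groupoid" where
  "fundamental_groupoid M W =
    \<lparr>verts = chambers W,
     edges = homotopy_class M W ` galleries M W,
     ini = (\<lambda>X. the_elem (gal_ini ` X)),
     ter = (\<lambda>X. the_elem (gal_ter W ` X)),
     idn = (\<lambda>C. homotopy_class M W (C, [])),
     cmp = (\<lambda>X Y. \<Union>\<beta>\<in>X. \<Union>\<beta>'\<in>Y. homotopy_class M W (gal_append \<beta> \<beta>'))\<rparr>"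


section \<open>Weyl graphs\<close>

locale pre_weyl_graph = weyl_data M W
  for M :: "'s coxeter_matrix" and W :: "('s, 'v, 'e) weyl_data" +
  assumes PW0: "s \<in> gens M \<Longrightarrow> P \<in> panels W s \<Longrightarrow> \<not> trivial_groupoid P"
    and PW1: "(s, t) \<in> finite_pairs M \<Longrightarrow> \<gamma> \<in> max_geodesics M W s t \<Longrightarrow>
      \<exists>\<gamma>' \<in> max_geodesics M W t s. (\<gamma>, \<gamma>') \<in> homotopy_rel M W"

locale weyl_graph = pre_weyl_graph M W
  for M :: "'s coxeter_matrix" and W :: "('s, 'v, 'e) weyl_data" +
  assumes W: "\<gamma> \<in> geodesics M W \<Longrightarrow> \<gamma>' \<in> geodesics M W \<Longrightarrow> (\<gamma>, \<gamma>') \<in> homotopy_rel M W \<Longrightarrow>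
    W_length M \<gamma> = W_length M \<gamma>'"

text \<open>
  In a Weyl graph every homotopy class contains a geodesic, and all geodesics in it have the
  same \<open>W\<close>-length, so the set below is a singleton.
\<close>

definition metrization ::
    "'s coxeter_matrix \<Rightarrow> ('s, 'v, 'e) weyl_data \<Rightarrow>
     ('s, 'v, 'e) gallery set \<Rightarrow> 's signed_word set" where
  "metrization M W X = the_elem (W_length M ` (X \<inter> geodesics M W))"


section \<open>\<open>W\<close>-groupoids and their associated Weyl data\<close>

locale W_groupoid = groupoid G
  for M :: "'s coxeter_matrix" and G :: "('v, 'e) groupoid"
    and \<delta> :: "'e \<Rightarrow> 's signed_word set" +
  assumes range: "g \<in> edges G \<Longrightarrow> \<delta> g \<in> carrier (coxeter_group M)"
    and weak: "C \<in> verts G \<Longrightarrow> s \<in> gens M \<Longrightarrow>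
      \<exists>g \<in> edges G. ini G g = C \<and> \<delta> g = gen_elt M s"
    and WG1: "C \<in> verts G \<Longrightarrow> \<delta> (idn G C) = \<one>\<^bsub>coxeter_group M\<^esub>"
    and WG2: "g \<in> edges G \<Longrightarrow> h \<in> edges G \<Longrightarrow> ter G g = ini G h \<Longrightarrow>
      bruhat_le M (\<delta> g \<otimes>\<^bsub>coxeter_group M\<^esub> \<delta> h) (\<delta> (cmp G g h))"
    and WG3: "g \<in> edges G \<Longrightarrow> s \<in> gens M \<Longrightarrow>
      bruhat_less M (\<delta> g \<otimes>\<^bsub>coxeter_group M\<^esub> gen_elt M s) (\<delta> g) \<Longrightarrow>
      \<exists>h \<in> edges G. ini G h = ini G g \<and> \<delta> (cmp G (inverse_edge G h) g) = gen_elt M s \<and>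
        \<delta> h = \<delta> g \<otimes>\<^bsub>coxeter_group M\<^esub> gen_elt M s"

locale strict_W_groupoid = W_groupoid M G \<delta>
  for M :: "'s coxeter_matrix" and G :: "('v, 'e) groupoid"
    and \<delta> :: "'e \<Rightarrow> 's signed_word set" +
  assumes strict: "g \<in> edges G \<Longrightarrow> \<delta> g = \<one>\<^bsub>coxeter_group M\<^esub> \<Longrightarrow> g = idn G (ini G g)"

definition parabolic_groupoid ::
    "'s coxeter_matrix \<Rightarrow> ('v, 'e) groupoid \<Rightarrow> ('e \<Rightarrow> 's signed_word set) \<Rightarrow> 's \<Rightarrow>
     ('v, 'e) groupoid" where
  "parabolic_groupoid M G \<delta> s =
    G\<lparr>edges := {g \<in> edges G. \<delta> g \<in> {\<one>\<^bsub>coxeter_group M\<^esub>, gen_elt M s}}\<rparr>"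

definition gal_composite :: "('v, 'e) groupoid \<Rightarrow> ('s, 'v, 'e) gallery \<Rightarrow> 'e" where
  "gal_composite G \<beta> = foldl (cmp G) (idn G (fst \<beta>)) (map snd (snd \<beta>))"

definition associated_chamber_system ::
    "'s coxeter_matrix \<Rightarrow> ('v, 'e) groupoid \<Rightarrow> ('e \<Rightarrow> 's signed_word set) \<Rightarrow>
     ('s, 'v, 'e) chamber_system" where
  "associated_chamber_system M G \<delta> =
    \<lparr>chambers = verts G, panel_gpd = parabolic_groupoid M G \<delta>\<rparr>"

definition associated_weyl_data ::
    "'s coxeter_matrix \<Rightarrow> ('v, 'e) groupoid \<Rightarrow> ('e \<Rightarrow> 's signed_word set) \<Rightarrow>
     ('s, 'v, 'e) weyl_data" where
  "associated_weyl_data M G \<delta> =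
    \<lparr>chambers = verts G, panel_gpd = parabolic_groupoid M G \<delta>,
     suites = (\<lambda>s t. {\<beta> \<in> st_cycles M (associated_chamber_system M G \<delta>) s t.
       gal_composite G \<beta> = idn G (gal_ini \<beta>)})\<rparr>"

end

theory Submission
  imports Defs Complex_Main
begin

text \<open>
  Composition in \<open>G\<close> sends a gallery to an edge, and the isomorphism is the inverse of this map on
  homotopy classes: \<open>\<psi> g\<close> is the set of all galleries with composite \<open>g\<close>. By WG2, applied to
  \<open>g h\<close> and to \<open>g = (g h) h\<^sup>-\<^sup>1\<close>, appending an edge of type \<open>s\<close> multiplies \<open>\<delta>\<close> by \<open>s\<close> as long as
  lengths increase, so the composite of a geodesic \<open>\<gamma>\<close> satisfies \<open>\<delta> = \<gamma>\<^sub>W\<close>. Conversely WG3 and strictness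
  split every edge along any reduced word of its \<open>\<delta>\<close>. Hence the maximal geodesics required by PW1
  exist, and they differ from the given ones by a defining suite.

  For injectivity, a loop with identity composite is homotopic to a geodesic, whose \<open>W\<close>-length is
  then trivial. That geodesics exist in each homotopy class is Tits' solution of the word problem
  lifted to galleries: a non-reduced word can be brought by braid moves to a word with a repeated letter.
  It rests on the exchange condition, which comes from the action of \<open>W\<close> on signed reflections, and
  on the fact that \<open>s t\<close> has order exactly \<open>m\<^sub>s\<^sub>t\<close>, which is read off the geometric representation.
\<close>

section \<open>Presented groups\<close>

text \<open>A presentation by itself only yields equalities. To tell elements of the Coxeter group
  apart, words are made to act on a set on which the relators act trivially. Three such actions
  occur: on a Boolean (parity of length), on the span of the simple roots (order of
  \<open>s t\<close>), and on signed group elements (reflections met by a word). The exact order of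
  \<open>s t\<close> matters because the words \<open>p(s,t)\<close> must be reduced: this makes the
  galleries in PW1 geodesics, and it stops the exchange condition from deleting a letter inside an
  alternating prefix. Two geodesics with equal composite have types that are reduced words of one
  element, and braid moves can make these types equal; but equal types do not yet give equal
  galleries. Injectivity therefore works with the loop \<open>xs ys^-1\<close>: its geodesic form
  has empty type, and only one gallery at a given chamber has this type. A loop of this form is also
  the defining suite needed for PW1. Since homotopy classes turn out to be the fibres of the
  composite, the groupoid axioms of the fundamental groupoid are transported from \<open>G\<close>
  rather than verified on classes.\<close>

lemma presentation_step_in_signed_words:
  assumes "presentation_step X R u v"
  shows "u \<in> signed_words X" "v \<in> signed_words X"
  using assms by (auto elim!: presentation_step.cases)

lemma presentation_step_context:
  assumes "presentation_step X R u v" "a \<in> signed_words X" "b \<in> signed_words X"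
  shows "presentation_step X R (a @ u @ b) (a @ v @ b)"
  using assms
proof (cases rule: presentation_step.cases)
  case (cancel u' v' x c)
  with assms show ?thesis
    using presentation_step.cancel[of "a @ u'" X "v' @ b" x R c] by simp
next
  case (relator u' v' r)
  with assms show ?thesis
    using presentation_step.relator[of "a @ u'" X "v' @ b" r R] by simp
qed

lemma equivclp_map:
  assumes "equivclp r x y" "\<And>x y. r x y \<Longrightarrow> equivclp q (f x) (f y)"
  shows "equivclp q (f x) (f y)"
  using assms(1)
proof (induction rule: equivclp_induct)
  case base
  show ?case by simp
next
  case (step y z)
  then show ?case
    using assms(2) by (meson equivclp_sym equivclp_trans)
qed

lemma presentation_rel_equiv: "equiv (signed_words X) (presentation_rel X R)"
  by (rule equivI)
    (auto simp: presentation_rel_def refl_on_def intro!: symI transI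
      intro: equivclp_sym equivclp_trans)

lemma presentation_rel_refl: "u \<in> signed_words X \<Longrightarrow> (u, u) \<in> presentation_rel X R"
  by (simp add: presentation_rel_def)

lemma presentation_rel_append:
  assumes "(u, u') \<in> presentation_rel X R" "(v, v') \<in> presentation_rel X R"
  shows "(u @ v, u' @ v') \<in> presentation_rel X R"
proof -
  have words: "u \<in> signed_words X" "u' \<in> signed_words X" "v \<in> signed_words X" "v' \<in> signed_words X"
    and eq: "equivclp (presentation_step X R) u u'" "equivclp (presentation_step X R) v v'"
    using assms by (auto simp: presentation_rel_def)
  have "equivclp (presentation_step X R) (u @ v) (u' @ v)"
    using presentation_step_context[of X R _ _ "[]" v] words
    by (intro equivclp_map[OF eq(1)]) auto
  moreover have "equivclp (presentation_step X R) (u' @ v) (u' @ v')"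
    using presentation_step_context[of X R _ _ u' "[]"] words
    by (intro equivclp_map[OF eq(2)]) auto
  ultimately show ?thesis
    using words by (auto simp: presentation_rel_def intro: equivclp_trans)
qed

lemma presentation_rel_step:
  "presentation_step X R u v \<Longrightarrow> (u, v) \<in> presentation_rel X R"
  using presentation_step_in_signed_words[of X R u v]
  by (auto simp: presentation_rel_def)

lemma presented_group_mult:
  assumes "u \<in> signed_words X" "v \<in> signed_words X"
  shows "presentation_rel X R `` {u} \<otimes>\<^bsub>presented_group X R\<^esub> presentation_rel X R `` {v}
    = presentation_rel X R `` {u @ v}"
proof -
  have "presentation_rel X R `` {a @ b} = presentation_rel X R `` {u @ v}"
    if "a \<in> presentation_rel X R `` {u}" "b \<in> presentation_rel X R `` {v}" for a b
  proof -
    have "(u @ v, a @ b) \<in> presentation_rel X R"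
      using that by (simp add: presentation_rel_append)
    then show ?thesis
      using equiv_class_eq[OF presentation_rel_equiv] by blast
  qed
  then have "(\<Union>a\<in>presentation_rel X R `` {u}. \<Union>b\<in>presentation_rel X R `` {v}.
        presentation_rel X R `` {a @ b}) =
      (\<Union>a\<in>presentation_rel X R `` {u}. \<Union>b\<in>presentation_rel X R `` {v}.
        presentation_rel X R `` {u @ v})"
    by (intro SUP_cong refl) simp
  moreover have "presentation_rel X R `` {u} \<noteq> {}" "presentation_rel X R `` {v} \<noteq> {}"
    using assms presentation_rel_refl by blast+
  ultimately show ?thesis
    unfolding presented_group_def by simp
qed


section \<open>Words in a Coxeter group\<close>

abbreviation positive :: "'s list \<Rightarrow> 's signed_word" where
  "positive \<equiv> map (\<lambda>s. (s, True))"

lemma alt_word_append: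
  "alt_word (m + n) s t = alt_word m s t @ (if even m then alt_word n s t else alt_word n t s)"
  by (induction m arbitrary: s t) auto

lemma length_alt_word [simp]: "length (alt_word n s t) = n"
  by (induction n arbitrary: s t) auto

lemma alt_word_Suc_right: "alt_word (Suc n) s t = alt_word n s t @ [if even n then s else t]"
  using alt_word_append[of n 1 s t] by simp

lemma rev_alt_word: "rev (alt_word n s t) = (if even n then alt_word n t s else alt_word n s t)"
proof (induction n arbitrary: s t)
  case (Suc n)
  then show ?case
    using alt_word_Suc_right[of n s t] alt_word_Suc_right[of n t s] by auto
qed simp

lemma set_alt_word: "set (alt_word n s t) \<subseteq> {s, t}"
proof (induction n arbitrary: s t)
  case (Suc n)
  then show ?case using Suc.IH[of t s] by auto
qed simp

context coxeter_matrix
begin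

abbreviation words :: "'s list set" where "words \<equiv> lists (gens M)"

abbreviation coxeter_rel where
  "coxeter_rel \<equiv> presentation_rel (gens M) (coxeter_relators M)"

lemma positive_in_signed_words [simp]: "positive w \<in> signed_words (gens M) \<longleftrightarrow> w \<in> words"
  by (induction w) auto

lemma rev_in_words [simp]: "rev w \<in> words \<longleftrightarrow> w \<in> words"
  by (simp add: in_lists_conv_set)

lemma word_elt_eq_iff:
  assumes "u \<in> words" "v \<in> words"
  shows "word_elt M u = word_elt M v \<longleftrightarrow> (positive u, positive v) \<in> coxeter_rel"
  unfolding word_elt_def
  by (rule eq_equiv_class_iff[OF presentation_rel_equiv]) (use assms in simp_all)

lemma word_elt_mult:
  assumes "u \<in> words" "v \<in> words"
  shows "word_elt M u \<otimes>\<^bsub>coxeter_group M\<^esub> word_elt M v = word_elt M (u @ v)"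
  using assms unfolding word_elt_def coxeter_group_def by (simp add: presented_group_mult)

lemma word_elt_one: "word_elt M [] = \<one>\<^bsub>coxeter_group M\<^esub>"
  by (simp add: word_elt_def coxeter_group_def presented_group_def)

lemma word_elt_cong:
  assumes "word_elt M u = word_elt M u'" "word_elt M v = word_elt M v'"
    "u \<in> words" "u' \<in> words" "v \<in> words" "v' \<in> words"
  shows "word_elt M (u @ v) = word_elt M (u' @ v')"
  using assms word_elt_mult by metis

lemma positive_double_relator:
  assumes "s \<in> gens M"
  shows "([(s, True), (s, True)], []) \<in> coxeter_rel"
proof -
  have "concat (replicate 1 [(s, True), (s, True)]) \<in> coxeter_relators M"
    unfolding coxeter_relators_def using assms cox_diag[of s] by (force simp: one_enat_def)
  then show ?thesis
    using presentation_step.relator[of "[]" "gens M" "[]" "[(s, True), (s, True)]"] assms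
    by (auto intro: presentation_rel_step)
qed

lemma word_elt_double:
  assumes "s \<in> gens M"
  shows "word_elt M [s, s] = word_elt M []"
  using positive_double_relator[OF assms] assms by (simp add: word_elt_eq_iff)

lemma word_elt_cancel:
  assumes "s \<in> gens M" "u \<in> words" "v \<in> words"
  shows "word_elt M (u @ s # s # v) = word_elt M (u @ v)"
  using word_elt_cong[OF word_elt_cong[OF refl[of "word_elt M u"] word_elt_double[OF assms(1)]]
      refl[of "word_elt M v"]] assms by simp

lemma word_elt_rev:
  assumes "u \<in> words"
  shows "word_elt M (u @ rev u) = word_elt M []"
  using assms
proof (induction u rule: rev_induct)
  case (snoc s u)
  then show ?case using word_elt_cancel[of s u "rev u"] by (simp add: in_lists_conv_set)
qed simp

lemma word_elt_rev_left:
  assumes "u \<in> words"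
  shows "word_elt M (rev u @ u) = word_elt M []"
  using word_elt_rev[of "rev u"] assms by simp

lemma word_elt_cancel_rev:
  assumes "u \<in> words" "v \<in> words" "w \<in> words"
  shows "word_elt M (u @ v @ rev v @ w) = word_elt M (u @ w)"
    "word_elt M (u @ rev v @ v @ w) = word_elt M (u @ w)"
  using word_elt_cong[OF word_elt_cong[OF refl[of "word_elt M u"] word_elt_rev[OF assms(2)]]
      refl[of "word_elt M w"]]
    word_elt_cong[OF word_elt_cong[OF refl[of "word_elt M u"] word_elt_rev_left[OF assms(2)]]
      refl[of "word_elt M w"]] assms by simp_all

lemma word_elt_left_cancel:
  assumes "word_elt M (a @ u) = word_elt M (a @ v)" "a \<in> words" "u \<in> words" "v \<in> words"
  shows "word_elt M u = word_elt M v"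
  using word_elt_cong[OF refl assms(1), of "rev a"] assms
    word_elt_cancel_rev(2)[of "[]" a u] word_elt_cancel_rev(2)[of "[]" a v] by simp

lemma word_elt_right_cancel:
  assumes "word_elt M (u @ a) = word_elt M (v @ a)" "a \<in> words" "u \<in> words" "v \<in> words"
  shows "word_elt M u = word_elt M v"
  using word_elt_cong[OF assms(1) refl, of "rev a"] assms
    word_elt_cancel_rev(1)[of u a "[]"] word_elt_cancel_rev(1)[of v a "[]"] by simp

lemma carrier_coxeter_group: "carrier (coxeter_group M) = word_elt M ` words"
proof -
  have ex: "\<exists>w \<in> words. (a, positive w) \<in> coxeter_rel" if "a \<in> signed_words (gens M)" for a
    using that
  proof (induction a rule: list.induct)
    case Nil
    then show ?case by (intro bexI[of _ "[]"]) (simp_all add: presentation_rel_refl)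
  next
    case (Cons x a)
    obtain s b where x: "x = (s, b)" by (cases x)
    have s: "s \<in> gens M" using Cons.prems x by simp
    have "([(s, b)], [(s, True)]) \<in> coxeter_rel"
    proof (cases b)
      case True
      then show ?thesis
        using s by (simp add: presentation_rel_refl)
    next
      case False
      \<comment> \<open>Inverse letters are eliminated by \<open>s^-1 ~ s^-1 s s ~ s\<close>: insert
        the relator \<open>s s\<close>, then cancel freely.\<close>
      have "([(s, False)] @ [(s, True), (s, True)], [(s, False)] @ []) \<in> coxeter_rel"
        using s positive_double_relator
        by (intro presentation_rel_append)
          (simp_all add: presentation_rel_refl)
      moreover have "([(s, False), (s, True), (s, True)], [(s, True)]) \<in> coxeter_rel"
        using s presentation_step.cancel[of "[]" "gens M" "[(s, True)]" s _ False]
        by (intro presentation_rel_step) simp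
      ultimately show ?thesis
        using False by (auto simp: presentation_rel_def intro: equivclp_sym equivclp_trans)
    qed
    moreover obtain w where "w \<in> words" "(a, positive w) \<in> coxeter_rel"
      using Cons by auto
    ultimately have "s # w \<in> words" "(x # a, positive (s # w)) \<in> coxeter_rel"
      using s presentation_rel_append[of "[(s, b)]" "[(s, True)]" _ _ a "positive w"]
      by (auto simp: x)
    then show ?case by blast
  qed
  show ?thesis
  proof (intro equalityI subsetI)
    fix x assume "x \<in> carrier (coxeter_group M)"
    then obtain a where a: "a \<in> signed_words (gens M)" "x = coxeter_rel `` {a}"
      by (auto simp: coxeter_group_def presented_group_def quotient_def)
    obtain w where w: "w \<in> words" "(a, positive w) \<in> coxeter_rel"
      using ex[OF a(1)] by auto
    have "x = word_elt M w"
      using a(2) equiv_class_eq[OF presentation_rel_equiv w(2)] by (simp add: word_elt_def)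
    then show "x \<in> word_elt M ` words"
      using w(1) by blast
  next
    fix x assume "x \<in> word_elt M ` words"
    then show "x \<in> carrier (coxeter_group M)"
      by (auto simp: word_elt_def coxeter_group_def presented_group_def intro!: quotientI)
  qed
qed

lemma word_elt_closed: "w \<in> words \<Longrightarrow> word_elt M w \<in> carrier (coxeter_group M)"
  by (simp add: carrier_coxeter_group)

lemma coxeter_group_elt:
  assumes "x \<in> carrier (coxeter_group M)"
  obtains w where "w \<in> words" "x = word_elt M w"
  using assms carrier_coxeter_group by auto

lemma group_coxeter_group: "group (coxeter_group M)"
proof (rule groupI)
  show "\<one>\<^bsub>coxeter_group M\<^esub> \<in> carrier (coxeter_group M)"
    using word_elt_closed[of "[]"] by (simp add: word_elt_one)
next
  fix x assume "x \<in> carrier (coxeter_group M)"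
  then obtain u where u: "u \<in> words" "x = word_elt M u" by (rule coxeter_group_elt)
  show "\<one>\<^bsub>coxeter_group M\<^esub> \<otimes>\<^bsub>coxeter_group M\<^esub> x = x"
    using u word_elt_mult[of "[]" u] by (simp add: word_elt_one)
  show "\<exists>y\<in>carrier (coxeter_group M). y \<otimes>\<^bsub>coxeter_group M\<^esub> x = \<one>\<^bsub>coxeter_group M\<^esub>"
    using u by (intro bexI[of _ "word_elt M (rev u)"])
      (simp_all add: word_elt_mult word_elt_rev_left word_elt_one word_elt_closed)
  fix y assume "y \<in> carrier (coxeter_group M)"
  then obtain v where v: "v \<in> words" "y = word_elt M v" by (rule coxeter_group_elt)
  then show "x \<otimes>\<^bsub>coxeter_group M\<^esub> y \<in> carrier (coxeter_group M)"
    using u by (simp add: word_elt_mult word_elt_closed)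
  fix z assume "z \<in> carrier (coxeter_group M)"
  then obtain w where "w \<in> words" "z = word_elt M w" by (rule coxeter_group_elt)
  then show "x \<otimes>\<^bsub>coxeter_group M\<^esub> y \<otimes>\<^bsub>coxeter_group M\<^esub> z =
      x \<otimes>\<^bsub>coxeter_group M\<^esub> (y \<otimes>\<^bsub>coxeter_group M\<^esub> z)"
    using u v by (simp add: word_elt_mult)
qed

lemma word_elt_alt_relator:
  assumes "s \<in> gens M" "t \<in> gens M" "cox M s t = enat m"
  shows "word_elt M (alt_word (2 * m) s t) = word_elt M []"
proof -
  have eq: "positive (alt_word (2 * m) s t) = concat (replicate m [(s, True), (t, True)])"
    by (induction m) auto
  have mem: "alt_word (2 * m) s t \<in> words"
    using set_alt_word[of "2 * m" s t] assms by auto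
  then have mem': "concat (replicate m [(s, True), (t, True)]) \<in> signed_words (gens M)"
    by (simp flip: eq)
  have "(positive (alt_word (2 * m) s t), []) \<in> coxeter_rel"
    using presentation_step.relator[of "[]" "gens M" "[]" _ "coxeter_relators M", OF _ _ _ mem'] assms
    unfolding eq by (intro presentation_rel_step) (auto simp: coxeter_relators_def)
  then show ?thesis using mem by (simp add: word_elt_eq_iff)
qed

lemma alt_word_in_words: "s \<in> gens M \<Longrightarrow> t \<in> gens M \<Longrightarrow> alt_word n s t \<in> words"
  using set_alt_word[of n s t] by auto

text \<open>The relator of length \<open>2 * m\<close> is \<open>p(s,t)\<close> followed by the
  reversal of \<open>p(t,s)\<close>, and reversal is inversion.\<close>

lemma alt_word_braid:
  assumes "s \<in> gens M" "t \<in> gens M" "cox M s t = enat m"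
  shows "word_elt M (alt_word m s t) = word_elt M (alt_word m t s)"
proof -
  have "alt_word (2 * m) s t = alt_word m s t @ rev (alt_word m t s)"
    using alt_word_append[of m m s t] by (auto simp: rev_alt_word mult_2)
  then have "word_elt M (alt_word m s t @ rev (alt_word m t s)) =
      word_elt M (alt_word m t s @ rev (alt_word m t s))"
    using word_elt_alt_relator[OF assms] word_elt_rev[of "alt_word m t s"] assms
    by (simp add: alt_word_in_words)
  then show ?thesis
    by (rule word_elt_right_cancel) (use assms in \<open>simp_all add: alt_word_in_words\<close>)
qed

text \<open>The tool for proving words different: maps that are involutions and satisfy the braid
  relators on an invariant set \<open>X\<close> make the group act on \<open>X\<close> from the left
  (\<open>foldr\<close> lets the last letter act first). It serves parity, the geometric
  representation and the signed reflections.\<close>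

lemma word_elt_action:
  assumes eq: "word_elt M u = word_elt M v" and uv: "u \<in> words" "v \<in> words"
    and closed: "\<And>s x. s \<in> gens M \<Longrightarrow> x \<in> X \<Longrightarrow> f s x \<in> X"
    and involution: "\<And>s x. s \<in> gens M \<Longrightarrow> x \<in> X \<Longrightarrow> f s (f s x) = x"
    and braid: "\<And>s t m x. s \<in> gens M \<Longrightarrow> t \<in> gens M \<Longrightarrow> s \<noteq> t \<Longrightarrow> cox M s t = enat m \<Longrightarrow>
      x \<in> X \<Longrightarrow> foldr f (alt_word (2 * m) s t) x = x"
    and x: "x \<in> X"
  shows "foldr f u x = foldr f v x"
proof -
  have fold_closed: "foldr f w y \<in> X" if "w \<in> words" "y \<in> X" for w y
    using that by (induction w) (auto intro: closed)
  have fst_words: "map fst a \<in> words" if "a \<in> signed_words (gens M)" for a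
    using that by (induction a) auto
  have step_eq: "foldr f (map fst a) y = foldr f (map fst b) y"
    if "presentation_step (gens M) (coxeter_relators M) a b" "y \<in> X" for a b y
    using that(1)
  proof (cases rule: presentation_step.cases)
    case (cancel a' b' z c)
    then show ?thesis
      using involution[of z "foldr f (map fst b') y"] fold_closed[of "map fst b'" y] that(2)
        fst_words[of b'] by simp
  next
    case (relator a' b' r)
    then obtain s t n where st: "s \<in> gens M" "t \<in> gens M" "cox M s t = enat n"
      and r: "r = concat (replicate n [(s, True), (t, True)])"
      by (auto simp: coxeter_relators_def)
    have r': "map fst r = alt_word (2 * n) s t"
      unfolding r by (induction n) auto
    define y' where "y' = foldr f (map fst b') y"
    have y': "y' \<in> X"
      unfolding y'_def using relator fold_closed fst_words that(2) by blast
    have "foldr f (alt_word (2 * n) s t) y' = y'"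
    proof (cases "s = t")
      case True
      then have "n = 1" using st cox_diag[of s] by (simp add: one_enat_def)
      then show ?thesis using True st y' by (simp add: numeral_2_eq_2 involution)
    next
      case False
      then show ?thesis using braid st y' by blast
    qed
    then show ?thesis using relator r' by (simp add: y'_def)
  qed
  have "equivclp (presentation_step (gens M) (coxeter_relators M)) (positive u) (positive v)"
    using eq uv by (simp add: word_elt_eq_iff presentation_rel_def)
  then have "foldr f (map fst (positive u)) x = foldr f (map fst (positive v)) x"
  proof (induction rule: equivclp_induct)
    case (step y z)
    then show ?case using step_eq[of y z x] step_eq[of z y x] x by auto
  qed simp
  then show ?thesis by (simp add: comp_def)
qed

text \<open>This is the sign character: every generator negates a Boolean, and all relators have
  even length.\<close>

lemma word_elt_parity:
  assumes "word_elt M u = word_elt M v" "u \<in> words" "v \<in> words"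
  shows "even (length u) \<longleftrightarrow> even (length v)"
proof -
  have foldr_not: "foldr (\<lambda>_ b. \<not> b) w x = (x = even (length w))" for w :: "'s list" and x
    by (induction w) auto
  have "foldr (\<lambda>_ b. \<not> b) u True = foldr (\<lambda>_ b. \<not> b) v True"
    by (rule word_elt_action[where X = UNIV, OF assms]) (auto simp: foldr_not)
  then show ?thesis by (simp add: foldr_not)
qed

end


section \<open>The geometric representation\<close>

context coxeter_matrix
begin

text \<open>The Gram matrix of the simple roots in Tits' geometric representation. A vector is its
  family of coefficients over the simple roots, \<open>form s v\<close> is its pairing with the root
  of \<open>s\<close>, and \<open>reflect s\<close> is the orthogonal reflection in that
  root.\<close>

definition bil :: "'s \<Rightarrow> 's \<Rightarrow> real" where
  "bil s t = (case cox M s t of enat m \<Rightarrow> - cos (pi / m) | \<infinity> \<Rightarrow> -1)"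

definition form :: "'s \<Rightarrow> ('s \<Rightarrow> real) \<Rightarrow> real" where
  "form s v = (\<Sum>r\<in>gens M. bil s r * v r)"

definition reflect :: "'s \<Rightarrow> ('s \<Rightarrow> real) \<Rightarrow> 's \<Rightarrow> real" where
  "reflect s v = v(s := v s - 2 * form s v)"

lemma bil_diag: "s \<in> gens M \<Longrightarrow> bil s s = 1"
  by (simp add: bil_def cox_diag one_enat_def)

lemma bil_sym: "s \<in> gens M \<Longrightarrow> t \<in> gens M \<Longrightarrow> bil s t = bil t s"
  by (simp add: bil_def cox_sym)

lemma form_update:
  assumes "r \<in> gens M"
  shows "form s (v(r := x)) = form s v + bil s r * (x - v r)"
proof -
  have "form s (v(r := x)) = (\<Sum>q\<in>gens M. bil s q * v q + (if q = r then bil s r * (x - v r) else 0))"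
    unfolding form_def by (intro sum.cong) (auto simp: algebra_simps)
  also have "\<dots> = form s v + bil s r * (x - v r)"
    using assms finite_gens by (simp add: sum.distrib form_def)
  finally show ?thesis .
qed

lemma form_zero: "form s (\<lambda>_. 0) = 0"
  by (simp add: form_def)

lemma reflect_involution: "s \<in> gens M \<Longrightarrow> reflect s (reflect s v) = v"
  by (simp add: reflect_def form_update bil_diag)

lemma cos_step:
  "cos (real_of_int (k + 1) * x) = 2 * cos x * cos (real_of_int k * x) - cos (real_of_int (k - 1) * x)"
  by (simp add: ring_distribs cos_add cos_diff)

text \<open>The coefficients of \<open>s\<close> and \<open>t\<close> change by partial sums of a sequence satisfying the Chebyshev
  recurrence of \<open>cos_step\<close>; the closed form below is the telescoped sum.\<close>

lemma reflect_pair_funpow: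
  assumes st: "s \<in> gens M" "t \<in> gens M" "s \<noteq> t" and m: "cox M s t = enat m"
  defines "c \<equiv> cos (pi / m)" and "K \<equiv> \<lambda>k. cos (real_of_int k * (pi / m))"
  shows "(reflect s \<circ> reflect t) ^^ j =
    (\<lambda>v. v(s := v s - (form t v * (c - K (2 * int j + 1)) + form s v * (1 - K (2 * int j))) / (1 - c\<^sup>2),
           t := v t - (form t v * (1 - K (2 * int j)) + form s v * (c - K (2 * int j - 1))) / (1 - c\<^sup>2)))"
proof (induction j)
  case 0
  show ?case by (simp add: K_def c_def fun_eq_iff)
next
  case (Suc j)
  have "2 \<le> m"
    using cox_offdiag[OF st] m by (simp add: numeral_eq_enat)
  then have "0 < sin (pi / m)"
    by (intro sin_gt_zero) (auto simp: field_simps)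
  then have D: "1 - c\<^sup>2 \<noteq> 0"
    using sin_cos_squared_add[of "pi / m"] by (auto simp: c_def power2_eq_square)
  have bil: "bil s t = - c" "bil t s = - c"
    using bil_sym[OF st(1,2)] m by (auto simp: bil_def c_def)
  have K_rec: "K (k + 1) = 2 * c * K k - K (k - 1)" for k
    unfolding K_def c_def by (rule cos_step)
  define x where "x = K (2 * int j)"
  define y where "y = K (2 * int j - 1)"
  have K: "K (2 * int j + 1) = 2 * c * x - y"
    "K (2 * int (Suc j) - 1) = 2 * c * x - y"
    "K (2 * int (Suc j)) = 2 * c * (2 * c * x - y) - x"
    "K (2 * int (Suc j) + 1) = 2 * c * (2 * c * (2 * c * x - y) - x) - (2 * c * x - y)"
    using K_rec[of "2 * int j"] K_rec[of "2 * int j + 1"] K_rec[of "2 * int j + 2"]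
    by (simp_all add: x_def y_def add.commute)
  show ?case
  proof (rule ext)
    fix v
    define a where "a = form s v"
    define b where "b = form t v"
    define A where "A = - (b * (c - (2 * c * x - y)) + a * (1 - x)) / (1 - c\<^sup>2)"
    define B where "B = - (b * (1 - x) + a * (c - y)) / (1 - c\<^sup>2)"
    define B' where "B' = - B - 2 * b + 2 * c * A"
    define A' where "A' = - A - 2 * a + 2 * c * B'"
    have IH: "((reflect s \<circ> reflect t) ^^ j) v = v(s := v s + A, t := v t + B)"
      unfolding Suc.IH K by (simp add: A_def B_def a_def b_def x_def y_def fun_eq_iff diff_divide_distrib add_divide_distrib)
    have AD: "A * (1 - c\<^sup>2) = - (b * (c - (2 * c * x - y)) + a * (1 - x))"
      and BD: "B * (1 - c\<^sup>2) = - (b * (1 - x) + a * (c - y))"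
      using D by (simp_all add: A_def B_def)
    have step_t: "reflect t (v(s := v s + A, t := v t + B)) = v(s := v s + A, t := v t + B')"
      using st by (simp add: reflect_def form_update bil bil_diag B'_def a_def b_def algebra_simps fun_upd_twist)
    have step_s: "reflect s (v(s := v s + A, t := v t + B')) = v(s := v s + A', t := v t + B')"
      using st by (simp add: reflect_def form_update bil bil_diag A'_def a_def b_def algebra_simps fun_upd_twist)
    have B'D: "B' * (1 - c\<^sup>2) = - (b * (1 - (2 * c * (2 * c * x - y) - x)) + a * (c - (2 * c * x - y)))"
      unfolding B'_def using AD BD by algebra
    moreover have "A' * (1 - c\<^sup>2) = - (b * (c - (2 * c * (2 * c * (2 * c * x - y) - x) - (2 * c * x - y)))
        + a * (1 - (2 * c * (2 * c * x - y) - x)))"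
      unfolding A'_def using AD B'D by algebra
    ultimately have eqs:
      "A' = - (b * (c - K (2 * int (Suc j) + 1)) + a * (1 - K (2 * int (Suc j)))) / (1 - c\<^sup>2)"
      "B' = - (b * (1 - K (2 * int (Suc j))) + a * (c - K (2 * int (Suc j) - 1))) / (1 - c\<^sup>2)"
      unfolding K using D by (simp_all add: eq_divide_eq)
    have "((reflect s \<circ> reflect t) ^^ Suc j) v = v(s := v s + A', t := v t + B')"
      using IH step_t step_s by simp
    then show "((reflect s \<circ> reflect t) ^^ Suc j) v = v(s := v s - (form t v * (c - K (2 * int (Suc j) + 1)) +
            form s v * (1 - K (2 * int (Suc j)))) / (1 - c\<^sup>2),
        t := v t - (form t v * (1 - K (2 * int (Suc j))) + form s v * (c - K (2 * int (Suc j) - 1))) / (1 - c\<^sup>2))"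
      by (simp only: eqs a_def b_def minus_divide_left[symmetric] add_uminus_conv_diff)
  qed
qed

lemma foldr_alt_word: "foldr f (alt_word (2 * n) s t) x = ((f s \<circ> f t) ^^ n) x"
  by (induction n) auto

text \<open>At \<open>j = m\<close> the three angles in the closed form exceed those at
  \<open>j = 0\<close> by a full turn, and at \<open>j = 0\<close> the map is the identity.\<close>

lemma reflect_pair_order:
  assumes st: "s \<in> gens M" "t \<in> gens M" "s \<noteq> t" and m: "cox M s t = enat m"
  shows "((reflect s \<circ> reflect t) ^^ m) v = v"
proof -
  have "2 \<le> m"
    using cox_offdiag[OF st] m by (simp add: numeral_eq_enat)
  then have "real_of_int (2 * int m + 1) * (pi / m) = pi / m + 2 * pi"
    "real_of_int (2 * int m) * (pi / m) = 2 * pi"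
    "real_of_int (2 * int m - 1) * (pi / m) = - (pi / m) + 2 * pi"
    by (simp_all add: field_simps)
  then show ?thesis
    unfolding reflect_pair_funpow[OF st m]
    by (simp only: cos_periodic cos_minus cos_two_pi) simp
qed

lemma reflect_word:
  assumes "word_elt M u = word_elt M v" "u \<in> words" "v \<in> words"
  shows "foldr reflect u = foldr reflect v"
proof
  fix x
  show "foldr reflect u x = foldr reflect v x"
    by (rule word_elt_action[where X = UNIV, OF assms])
      (auto simp: reflect_involution foldr_alt_word reflect_pair_order)
qed

text \<open>Here \<open>bil s t = -1\<close>, so the denominator of the finite closed form would
  vanish. The product is unipotent on the plane of the two roots, and coefficients grow
  linearly.\<close>

lemma reflect_pair_funpow_infinite:
  assumes st: "s \<in> gens M" "t \<in> gens M" "s \<noteq> t" and m: "cox M s t = \<infinity>"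
  shows "((reflect s \<circ> reflect t) ^^ j) ((\<lambda>_. 0)(s := 1)) = (\<lambda>_. 0)(s := 2 * real j + 1, t := 2 * real j)"
proof (induction j)
  case 0
  show ?case using st by (auto simp: fun_eq_iff)
next
  case (Suc j)
  have bil: "bil s t = - 1" "bil t s = - 1"
    using bil_sym[OF st(1,2)] m by (auto simp: bil_def)
  have "((reflect s \<circ> reflect t) ^^ Suc j) ((\<lambda>_. 0)(s := 1)) =
      (reflect s \<circ> reflect t) (((reflect s \<circ> reflect t) ^^ j) ((\<lambda>_. 0)(s := 1)))"
    by simp
  also have "\<dots> = reflect s (reflect t ((\<lambda>_. 0)(s := 2 * real j + 1, t := 2 * real j)))"
    unfolding Suc.IH by simp
  also have "\<dots> = (\<lambda>_. 0)(s := 2 * real (Suc j) + 1, t := 2 * real (Suc j))"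
    using st
    by (auto simp: reflect_def form_update bil bil_diag form_zero fun_upd_twist fun_eq_iff)
  finally show ?case .
qed

text \<open>Together with the relators this makes \<open>m\<close> the exact order of
  \<open>s t\<close>: a smaller positive power visibly moves a vector.\<close>

lemma alt_word_nontrivial:
  assumes st: "s \<in> gens M" "t \<in> gens M" "s \<noteq> t" and j: "0 < j" "enat j < cox M s t"
  shows "word_elt M (alt_word (2 * j) s t) \<noteq> word_elt M []"
proof
  assume "word_elt M (alt_word (2 * j) s t) = word_elt M []"
  then have "foldr reflect (alt_word (2 * j) s t) = foldr reflect []"
    by (rule reflect_word) (simp_all add: alt_word_in_words st)
  then have triv: "((reflect s \<circ> reflect t) ^^ j) v = v" for v
    using foldr_alt_word[of reflect j s t v] by simp
  show False
  proof (cases "cox M s t")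
    case (enat m)
    have "2 \<le> m"
      using cox_offdiag[OF st] enat by (simp add: numeral_eq_enat)
    have bil: "bil s t = - cos (pi / m)" "bil t s = - cos (pi / m)"
      using bil_sym[OF st(1,2)] enat by (auto simp: bil_def)
    define D where "D = 1 - (cos (pi / m))\<^sup>2"
    have "0 < sin (pi / m)"
      using \<open>2 \<le> m\<close> by (intro sin_gt_zero) (auto simp: field_simps)
    then have D: "D \<noteq> 0"
      using sin_cos_squared_add[of "pi / m"] by (auto simp: D_def power2_eq_square)
    \<comment> \<open>The component of the root of \<open>s\<close> orthogonal to the root of
      \<open>t\<close>: the terms with \<open>form t v\<close> drop out, and \<open>form s v\<close>
      cancels the denominator, leaving only the cosine of \<open>2 * j * pi / m\<close>.\<close>
    define v where "v = (\<lambda>_. 0 :: real)(s := 1, t := cos (pi / m))"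
    have "form s v = D" "form t v = 0"
      using st by (simp_all add: v_def form_update form_zero bil bil_diag D_def power2_eq_square)
    then have "((reflect s \<circ> reflect t) ^^ j) v s = v s - (1 - cos (real_of_int (2 * int j) * (pi / m)))"
      unfolding reflect_pair_funpow[OF st enat] using st D by (simp add: D_def)
    then have one: "cos (2 * (j * pi / m)) = 1"
      using triv[of v] by (simp add: mult.assoc)
    have "j < m" using j enat by simp
    then have "0 < j * pi / m" "j * pi / m < pi"
      using j(1) by (simp_all add: field_simps)
    then have "0 < sin (j * pi / m)" by (rule sin_gt_zero)
    moreover have "cos (2 * (j * pi / m)) = 1 - 2 * (sin (j * pi / m))\<^sup>2"
      by (rule cos_double_sin)
    ultimately show False using one by simp
  next
    case infinity
    have "((reflect s \<circ> reflect t) ^^ j) ((\<lambda>_. 0)(s := 1)) t = 2 * real j"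
      unfolding reflect_pair_funpow_infinite[OF st infinity] using st by simp
    then show False
      using triv[of "(\<lambda>_. 0)(s := 1)"] st j(1) by simp
  qed
qed

end


text \<open>Alternating words of odd length are palindromes, hence conjugates of generators: they
  are the reflections of the dihedral subgroup.\<close>

lemma alt_word_palindrome:
  "alt_word n a b @ (if even n then a else b) # rev (alt_word n a b) = alt_word (2 * n + 1) a b"
proof -
  have "2 * n + 1 = Suc n + n" by simp
  then have "alt_word (2 * n + 1) a b = alt_word (Suc n + n) a b" by (simp only:)
  then show ?thesis
    by (simp only: alt_word_append alt_word_Suc_right rev_alt_word) simp
qed

lemma count_list_distinct: "distinct xs \<Longrightarrow> x \<in> set xs \<Longrightarrow> count_list xs x = 1"
  by (induction xs) (auto simp: count_list_0_iff)

lemma subseq_set_subset: "subseq u v \<Longrightarrow> set u \<subseteq> set v"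
  by (induction rule: list_emb.induct) auto

context coxeter_matrix
begin

section \<open>Reflections and the exchange condition\<close>

text \<open>For \<open>w = s_1 ... s_n\<close> the entry at \<open>s_i\<close> is the reflection
  \<open>s_n ... s_i ... s_n\<close>; multiplying \<open>w\<close> by it on the right deletes the
  letter \<open>s_i\<close>. For reduced \<open>w\<close> these are its inversions.\<close>

primrec refl_seq :: "'s list \<Rightarrow> 's signed_word set list" where
  "refl_seq [] = []"
| "refl_seq (s # w) = word_elt M (rev w @ s # w) # refl_seq w"

text \<open>The action on signed reflections, extended to all signed group elements so that no set
  of reflections has to be singled out. The sign changes exactly when \<open>s\<close> meets
  itself.\<close>

definition conj_act :: "'s \<Rightarrow> 's signed_word set \<times> bool \<Rightarrow> 's signed_word set \<times> bool" where
  "conj_act s = (\<lambda>(x, b). (gen_elt M s \<otimes>\<^bsub>coxeter_group M\<^esub> x \<otimes>\<^bsub>coxeter_group M\<^esub> gen_elt M s,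
    b \<noteq> (x = gen_elt M s)))"

lemma length_refl_seq [simp]: "length (refl_seq w) = length w"
  by (induction w) auto

lemma conj_act_word:
  "s \<in> gens M \<Longrightarrow> x \<in> words \<Longrightarrow>
    conj_act s (word_elt M x, b) = (word_elt M (s # x @ [s]), b \<noteq> (word_elt M x = gen_elt M s))"
  by (simp add: conj_act_def word_elt_mult)

lemma conj_eq_iff:
  assumes "u \<in> words" "v \<in> words" "w \<in> words"
  shows "word_elt M (u @ v @ rev u) = word_elt M w \<longleftrightarrow> word_elt M v = word_elt M (rev u @ w @ u)"
proof
  assume "word_elt M (u @ v @ rev u) = word_elt M w"
  then have "word_elt M (rev u @ (u @ v @ rev u) @ u) = word_elt M (rev u @ w @ u)"
    using assms by (intro word_elt_cong refl) simp_all
  then show "word_elt M v = word_elt M (rev u @ w @ u)"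
    using assms word_elt_cancel_rev(2)[of "[]" u "v @ rev u @ u"] word_elt_cancel_rev(2)[of v u "[]"]
    by simp
next
  assume "word_elt M v = word_elt M (rev u @ w @ u)"
  then have "word_elt M (u @ v @ rev u) = word_elt M (u @ (rev u @ w @ u) @ rev u)"
    using assms by (intro word_elt_cong refl) simp_all
  then show "word_elt M (u @ v @ rev u) = word_elt M w"
    using assms word_elt_cancel_rev(1)[of "[]" u "w @ u @ rev u"] word_elt_cancel_rev(1)[of w u "[]"]
    by simp
qed

text \<open>A letter \<open>s\<close> in front of \<open>w\<close> flips the sign iff
  \<open>w x w^-1 = s\<close>, that is, iff \<open>x\<close> is the entry \<open>w^-1 s w\<close>
  which that letter adds to \<open>refl_seq\<close>.\<close>

lemma foldr_conj_act:
  assumes "w \<in> words" "x \<in> words"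
  shows "foldr conj_act w (word_elt M x, b) =
    (word_elt M (w @ x @ rev w), b \<noteq> odd (count_list (refl_seq w) (word_elt M x)))"
  using assms(1)
proof (induction w rule: list.induct)
  case (Cons s w)
  then have sw: "s \<in> gens M" "w \<in> words" by simp_all
  then have "word_elt M (w @ x @ rev w) = gen_elt M s \<longleftrightarrow> word_elt M (rev w @ s # w) = word_elt M x"
    using conj_eq_iff[of w x "[s]"] assms(2) by auto
  then show ?case using Cons sw assms(2) by (auto simp: conj_act_word)
qed simp

text \<open>The reversed word always ends in \<open>a\<close>, so a further letter puts one new
  entry in front and leaves the others unchanged.\<close>

lemma refl_seq_rev_alt_word:
  "refl_seq (rev (alt_word n a b)) = rev (map (\<lambda>i. word_elt M (alt_word (2 * i + 1) a b)) [0..<n])"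
proof (induction n)
  case (Suc n)
  have "rev (alt_word (Suc n) a b) = (if even n then a else b) # rev (alt_word n a b)"
    by (simp only: alt_word_Suc_right) simp
  then have "refl_seq (rev (alt_word (Suc n) a b)) =
      word_elt M (alt_word n a b @ (if even n then a else b) # rev (alt_word n a b))
      # refl_seq (rev (alt_word n a b))"
    by simp
  also have "\<dots> = word_elt M (alt_word (2 * n + 1) a b) # refl_seq (rev (alt_word n a b))"
    by (simp only: alt_word_palindrome)
  finally show ?case using Suc.IH by simp
qed simp

text \<open>The \<open>2 * m\<close> entries repeat with period \<open>m\<close>, because raising
  the index by \<open>m\<close> prepends a relator. Hence the relator acts trivially on
  signs.\<close>

lemma even_count_refl_seq_relator:
  assumes st: "s \<in> gens M" "t \<in> gens M" and m: "cox M s t = enat m"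
  shows "even (count_list (refl_seq (alt_word (2 * m) s t)) x)"
proof -
  \<comment> \<open>The words start with \<open>t\<close> because
    \<open>alt_word (2 * m) s t\<close> is the reversal of
    \<open>alt_word (2 * m) t s\<close>.\<close>
  define f where "f = (\<lambda>i. word_elt M (alt_word (2 * i + 1) t s))"
  have period: "f (i + m) = f i" for i
  proof -
    have "alt_word (2 * (i + m) + 1) t s = alt_word (2 * m + (2 * i + 1)) t s"
      by (simp only: distrib_left add.commute add.left_commute)
    also have "\<dots> = alt_word (2 * m) t s @ alt_word (2 * i + 1) t s"
      by (simp only: alt_word_append) simp
    finally have eq: "alt_word (2 * (i + m) + 1) t s = alt_word (2 * m) t s @ alt_word (2 * i + 1) t s" .
    have "word_elt M (alt_word (2 * m) t s) = word_elt M []"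
      using word_elt_alt_relator[of t s m] st m cox_sym[of s t] by simp
    then have "word_elt M (alt_word (2 * m) t s @ alt_word (2 * i + 1) t s)
        = word_elt M ([] @ alt_word (2 * i + 1) t s)"
      by (rule word_elt_cong[OF _ refl]) (intro alt_word_in_words st lists.Nil)+
    then show ?thesis unfolding f_def eq by simp
  qed
  have "map f [0..<2 * m] = map f [0..<m] @ map f [m..<m + m]"
    using upt_add_eq_append[of 0 m m] by (simp add: mult_2)
  also have "[m..<m + m] = map (\<lambda>i. i + m) [0..<m]"
    by (simp add: map_add_upt)
  also have "map f (map (\<lambda>i. i + m) [0..<m]) = map f [0..<m]"
    by (simp add: period)
  finally have "map f [0..<2 * m] = map f [0..<m] @ map f [0..<m]" .
  moreover have "refl_seq (alt_word (2 * m) s t) = rev (map f [0..<2 * m])"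
    using refl_seq_rev_alt_word[of "2 * m" t s] rev_alt_word[of "2 * m" t s] by (simp add: f_def)
  ultimately show ?thesis
    by (simp only: count_list_rev count_list_append) simp
qed

lemma refl_seq_parity:
  assumes "word_elt M u = word_elt M v" "u \<in> words" "v \<in> words" "x \<in> words"
  shows "odd (count_list (refl_seq u) (word_elt M x)) \<longleftrightarrow> odd (count_list (refl_seq v) (word_elt M x))"
proof -
  have "foldr conj_act u (word_elt M x, False) = foldr conj_act v (word_elt M x, False)"
  proof (rule word_elt_action[where X = "carrier (coxeter_group M) \<times> UNIV", OF assms(1-3)])
    fix s z assume s: "s \<in> gens M" and z: "z \<in> carrier (coxeter_group M) \<times> (UNIV :: bool set)"
    obtain x b where x: "x \<in> carrier (coxeter_group M)" "z = (x, b)" using z by auto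
    obtain w where w: "w \<in> words" "z = (word_elt M w, b)"
      using coxeter_group_elt[OF x(1)] x(2) by metis
    then show "conj_act s z \<in> carrier (coxeter_group M) \<times> UNIV"
      using s by (simp add: conj_act_word word_elt_closed)
    have "word_elt M (s # s # w @ [s, s]) = word_elt M w"
      using s w word_elt_cancel[of s "[]" "w @ [s, s]"] word_elt_cancel[of s w "[]"] by simp
    \<comment> \<open>Either both applications of \<open>s\<close> flip the sign or neither
      does.\<close>
    moreover have "word_elt M (s # w @ [s]) = gen_elt M s \<longleftrightarrow> word_elt M w = gen_elt M s"
      using conj_eq_iff[of "[s]" w "[s]"] s w word_elt_cancel[of s "[]" "[s]"] by simp
    ultimately show "conj_act s (conj_act s z) = z"
      using s w by (simp add: conj_act_word) blast
    fix t m assume t: "t \<in> gens M" and m: "cox M s t = enat m"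
    have alt: "alt_word (2 * m) s t \<in> words" using s t by (rule alt_word_in_words)
    have "word_elt M (alt_word (2 * m) s t @ w @ rev (alt_word (2 * m) s t)) = word_elt M ([] @ w @ rev [])"
      using word_elt_alt_relator[OF s t m] word_elt_alt_relator[of t s m] m cox_sym[OF s t] s t w alt
      by (intro word_elt_cong refl) (simp_all add: rev_alt_word alt_word_in_words)
    then show "foldr conj_act (alt_word (2 * m) s t) z = z"
      using w alt even_count_refl_seq_relator[OF s t m] by (simp add: foldr_conj_act)
  qed (use assms in \<open>simp add: word_elt_closed\<close>)
  then show ?thesis using assms by (simp add: foldr_conj_act)
qed

lemma refl_seq_memD:
  assumes "x \<in> set (refl_seq w)"
  shows "\<exists>u a v. w = u @ a # v \<and> x = word_elt M (rev v @ a # v)"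
  using assms
proof (induction w)
  case (Cons s w)
  show ?case
  proof (cases "x = word_elt M (rev w @ s # w)")
    case True
    then show ?thesis by blast
  next
    case False
    then obtain u a v where "w = u @ a # v" "x = word_elt M (rev v @ a # v)"
      using Cons by auto
    then show ?thesis by (intro exI[of _ "s # u"]) auto
  qed
qed simp

section \<open>Reduced words and their factors\<close>

lemma reducedD: "reduced M w \<Longrightarrow> v \<in> words \<Longrightarrow> word_elt M v = word_elt M w \<Longrightarrow> length w \<le> length v"
  by (auto simp: reduced_def not_less)

lemma reduced_words: "reduced M w \<Longrightarrow> w \<in> words"
  by (simp add: reduced_def)

lemma reducedI:
  "w \<in> words \<Longrightarrow> (\<And>v. v \<in> words \<Longrightarrow> word_elt M v = word_elt M w \<Longrightarrow> length w \<le> length v) \<Longrightarrow> reduced M w"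
  unfolding reduced_def by (meson not_le)

lemma reduced_same_length:
  assumes "reduced M u" "v \<in> words" "word_elt M v = word_elt M u" "length v = length u"
  shows "reduced M v"
  using assms reducedD[OF assms(1)] by (intro reducedI) auto

lemma reduced_length_eq:
  assumes "reduced M u" "reduced M v" "word_elt M u = word_elt M v"
  shows "length u = length v"
  using assms reducedD[of u v] reducedD[of v u] by (simp add: reduced_words)

lemma reduced_Nil: "reduced M []"
  by (simp add: reducedI)

lemma reduced_appendD:
  assumes "reduced M (u @ v)"
  shows "reduced M u" "reduced M v"
proof -
  have uv: "u \<in> words" "v \<in> words" using reduced_words[OF assms] by simp_all
  show "reduced M u"
  proof (rule reducedI[OF uv(1)])
    fix w assume "w \<in> words" "word_elt M w = word_elt M u"
    then show "length u \<le> length w"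
      using reducedD[OF assms, of "w @ v"] word_elt_cong[of w u v v] uv by simp
  qed
  show "reduced M v"
  proof (rule reducedI[OF uv(2)])
    fix w assume "w \<in> words" "word_elt M w = word_elt M v"
    then show "length v \<le> length w"
      using reducedD[OF assms, of "u @ w"] word_elt_cong[of u u w v] uv by simp
  qed
qed

text \<open>Multiply the two expressions \<open>w^-1 s w = v^-1 a v\<close> of one reflection by
  \<open>w\<close> on the left: one becomes \<open>s w\<close>, the other \<open>w\<close> without
  its letter \<open>a\<close>.\<close>

lemma refl_exchange:
  assumes w: "w \<in> words" "s \<in> gens M" and mem: "word_elt M (rev w @ s # w) \<in> set (refl_seq w)"
  shows "\<exists>u a v. w = u @ a # v \<and> word_elt M (s # w) = word_elt M (u @ v)"
proof -
  obtain u a v where uv: "w = u @ a # v" "word_elt M (rev w @ s # w) = word_elt M (rev v @ a # v)"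
    using refl_seq_memD[OF mem] by blast
  have "word_elt M (w @ rev w @ s # w) = word_elt M (w @ rev v @ a # v)"
    using uv w word_elt_cong[of w w "rev w @ s # w" "rev v @ a # v"] by simp
  moreover have "word_elt M (w @ rev w @ s # w) = word_elt M (s # w)"
    using word_elt_cancel_rev(1)[of "[]" w "s # w"] w by simp
  moreover have "word_elt M (w @ rev v @ a # v) = word_elt M (u @ v)"
    using word_elt_cancel_rev(1)[of "u @ [a]" v "a # v"] word_elt_cancel[of a u v] w uv(1) by simp
  ultimately show ?thesis using uv(1) by blast
qed

text \<open>An entry occurring once has odd multiplicity, so by parity it occurs for every word of
  the same element. Such a word needs at least as many letters as there are distinct
  entries.\<close>

lemma distinct_refl_seq_imp_reduced:
  assumes "w \<in> words" "distinct (refl_seq w)"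
  shows "reduced M w"
proof (rule reducedI[OF assms(1)])
  fix v assume v: "v \<in> words" "word_elt M v = word_elt M w"
  have "set (refl_seq w) \<subseteq> set (refl_seq v)"
  proof
    fix x assume x: "x \<in> set (refl_seq w)"
    then obtain p a q where p: "w = p @ a # q" "x = word_elt M (rev q @ a # q)"
      using refl_seq_memD by blast
    define u where "u = rev q @ a # q"
    have u: "u \<in> words" "x = word_elt M u" using p assms(1) by (simp_all add: u_def)
    have "count_list (refl_seq w) x = 1"
      using x assms(2) by (rule count_list_distinct[rotated])
    then show "x \<in> set (refl_seq v)"
      using refl_seq_parity[OF v(2,1) assms(1) u(1)] u(2) by (metis count_list_0_iff even_zero odd_one)
  qed
  then have "card (set (refl_seq w)) \<le> card (set (refl_seq v))"
    by (intro card_mono) auto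
  then show "length w \<le> length v"
    using assms(2) card_length[of "refl_seq v"] by (simp add: distinct_card)
qed

text \<open>If the new head entry occurred again, \<open>refl_exchange\<close> would give a word of
  the same element with two letters fewer.\<close>

lemma reduced_imp_distinct_refl_seq:
  assumes "reduced M w"
  shows "distinct (refl_seq w)"
  using assms
proof (induction w)
  case (Cons s w)
  have w: "reduced M w" "w \<in> words" "s \<in> gens M"
    using reduced_appendD(2)[of "[s]" w] reduced_words[OF Cons.prems] Cons.prems by auto
  have "word_elt M (rev w @ s # w) \<notin> set (refl_seq w)"
  proof
    assume "word_elt M (rev w @ s # w) \<in> set (refl_seq w)"
    then obtain u a v where "w = u @ a # v" "word_elt M (s # w) = word_elt M (u @ v)"
      using refl_exchange[OF w(2,3)] by blast
    then show False using reducedD[OF Cons.prems, of "u @ v"] w by simp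
  qed
  then show ?case using Cons.IH w by simp
qed simp

lemma exchange:
  assumes "reduced M w" "s \<in> gens M" "\<not> reduced M (s # w)"
  obtains u a v where "w = u @ a # v" "word_elt M (s # w) = word_elt M (u @ v)"
proof -
  have "word_elt M (rev w @ s # w) \<in> set (refl_seq w)"
    using distinct_refl_seq_imp_reduced[of "s # w"] reduced_imp_distinct_refl_seq[OF assms(1)]
      assms reduced_words[OF assms(1)] by auto
  then show ?thesis
    using refl_exchange[of w s] assms reduced_words[OF assms(1)] that by blast
qed

text \<open>Two equal entries of \<open>refl_seq\<close> would, after cancelling the common odd
  suffix, make a power of \<open>s t\<close> trivial whose exponent is a positive difference of
  indices below \<open>k\<close>.\<close>

lemma reduced_alt_word:
  assumes st: "s \<in> gens M" "t \<in> gens M" "s \<noteq> t" and k: "enat k \<le> cox M s t"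
  shows "reduced M (alt_word k s t)"
proof -
  have dist: "distinct (refl_seq (rev (alt_word k a b)))"
    if ab: "a \<in> gens M" "b \<in> gens M" "a \<noteq> b" and k: "enat k \<le> cox M a b" for a b
  proof -
    have neq: "word_elt M (alt_word (2 * i + 1) a b) \<noteq> word_elt M (alt_word (2 * j + 1) a b)"
      if "i < j" "j < k" for i j
    proof
      assume eq: "word_elt M (alt_word (2 * i + 1) a b) = word_elt M (alt_word (2 * j + 1) a b)"
      have "2 * j + 1 = 2 * (j - i) + (2 * i + 1)" using that by simp
      then have alt: "alt_word (2 * j + 1) a b = alt_word (2 * (j - i)) a b @ alt_word (2 * i + 1) a b"
        using alt_word_append[of "2 * (j - i)" "2 * i + 1" a b]
        by (simp only: dvd_triv_left if_True)
      have "word_elt M (alt_word (2 * (j - i)) a b @ alt_word (2 * i + 1) a b) =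
          word_elt M ([] @ alt_word (2 * i + 1) a b)"
        using eq[unfolded alt] by (simp only: append_Nil)
      then have "word_elt M (alt_word (2 * (j - i)) a b) = word_elt M []"
        by (rule word_elt_right_cancel) (intro alt_word_in_words ab lists.Nil)+
      moreover have "enat (j - i) < cox M a b"
        using that k by (meson diff_le_self enat_ord_simps(2) le_less_trans order_less_le_trans)
      ultimately show False using alt_word_nontrivial[OF ab, of "j - i"] that by simp
    qed
    have "inj_on (\<lambda>i. word_elt M (alt_word (2 * i + 1) a b)) {0..<k}"
    proof (rule inj_onI)
      fix i j assume "i \<in> {0..<k}" "j \<in> {0..<k}"
        "word_elt M (alt_word (2 * i + 1) a b) = word_elt M (alt_word (2 * j + 1) a b)"
      then show "i = j" using neq[of i j] neq[of j i] by (cases i j rule: linorder_cases) auto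
    qed
    then show ?thesis
      unfolding refl_seq_rev_alt_word by (simp only: distinct_rev distinct_map distinct_upt set_upt simp_thms)
  qed
  have "distinct (refl_seq (alt_word k s t))"
    \<comment> \<open>By the parity of \<open>k\<close>, the word is the reversal of an alternating
      word starting with \<open>t\<close> or with \<open>s\<close>, so both orders are
      needed.\<close>
    using dist[of s t] dist[of t s] st k cox_sym[of s t] by (cases "even k") (auto simp: rev_alt_word)
  then show ?thesis
    by (intro distinct_refl_seq_imp_reduced alt_word_in_words st)
qed


section \<open>Braid moves\<close>

inductive braid_step :: "'s list \<Rightarrow> 's list \<Rightarrow> bool" where
  "(s, t) \<in> finite_pairs M \<Longrightarrow> m = the_enat (cox M s t) \<Longrightarrow>
    braid_step (u @ alt_word m s t @ v) (u @ alt_word m t s @ v)"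

lemma braid_step_Cons: "braid_step u v \<Longrightarrow> braid_step (a # u) (a # v)"
proof (induction rule: braid_step.induct)
  case (1 s t m u v)
  then show ?case using braid_step.intros[of s t m "a # u" v] by simp
qed

lemma braid_steps_Cons: "braid_step\<^sup>*\<^sup>* u v \<Longrightarrow> braid_step\<^sup>*\<^sup>* (a # u) (a # v)"
  by (induction rule: rtranclp_induct) (auto intro: braid_step_Cons rtranclp.rtrancl_into_rtrancl)

text \<open>Induction with \<open>s\<close> and \<open>t\<close> swapped. A reduced word with prefix
  \<open>tst...\<close> stops being reduced when \<open>s\<close> is put in front, so exchange
  deletes one of its letters. This letter lies behind the prefix, and putting \<open>s\<close> in
  its place gives the longer prefix \<open>stst...\<close>.\<close>

lemma alternating_descents:
  assumes "reduced M (s # u)" "reduced M (t # v)" "word_elt M (s # u) = word_elt M (t # v)"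
    "s \<noteq> t" "enat (Suc k) \<le> cox M s t"
  shows "\<exists>x. reduced M (alt_word (Suc k) s t @ x) \<and>
    word_elt M (alt_word (Suc k) s t @ x) = word_elt M (s # u)"
  using assms
proof (induction k arbitrary: s t u v)
  case 0
  then show ?case by auto
next
  case (Suc k)
  have st: "s \<in> gens M" "t \<in> gens M" "u \<in> words" "v \<in> words"
    using Suc.prems reduced_words by force+
  have k: "enat (Suc k) \<le> cox M t s"
    using Suc.prems(5) cox_sym[OF st(1,2)] by (metis Suc_leD enat_ord_simps(1) order_trans order_refl)
  obtain y where y: "reduced M (alt_word (Suc k) t s @ y)"
    "word_elt M (alt_word (Suc k) t s @ y) = word_elt M (s # u)"
    using Suc.IH[OF Suc.prems(2,1) Suc.prems(3)[symmetric] _ k] Suc.prems(3,4) by auto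
  define p where "p = alt_word (Suc k) t s"
  have p: "p \<in> words" "y \<in> words" using y(1)[THEN reduced_words] by (simp_all add: p_def)
  have len: "length (p @ y) = length (s # u)"
    using reduced_length_eq[OF y(1) Suc.prems(1) y(2)] by (simp add: p_def)
  have "word_elt M (s # p @ y) = word_elt M (s # s # u)"
    using word_elt_cong[OF refl y(2), of "[s]"] st p by (simp add: p_def)
  then have su: "word_elt M (s # p @ y) = word_elt M u"
    using word_elt_cancel[of s "[]" u] st by simp
  \<comment> \<open>The word \<open>s # p @ y\<close> is two letters longer than \<open>u\<close>,
    which represents the same element.\<close>
  then have "\<not> reduced M (s # p @ y)"
    using reducedD[of "s # p @ y" u] st len by auto
  then obtain q a r where qr: "p @ y = q @ a # r" "word_elt M (s # p @ y) = word_elt M (q @ r)"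
    using exchange[of "p @ y" s] y(1) st(1) by (auto simp: p_def)
  have qr': "q \<in> words" "a \<in> gens M" "r \<in> words"
    using p qr(1) by (metis append_in_lists_conv Cons_in_lists_iff)+
  show ?case
  proof (cases "length p \<le> length q")
    case True
    then obtain q' where q: "q = p @ q'" "y = q' @ a # r"
      using qr(1) by (auto simp: append_eq_append_conv2 append_eq_Cons_conv Cons_eq_append_conv)
    have alt: "alt_word (Suc (Suc k)) s t @ q' @ r = s # q @ r"
      by (simp add: q p_def)
    have "word_elt M (s # q @ r) = word_elt M (s # s # p @ y)"
      using word_elt_cong[OF refl qr(2)[symmetric], of "[s]"] st p qr' by simp
    also have "\<dots> = word_elt M (s # u)"
      using word_elt_cancel[of s "[]" "p @ y"] st p y(2) by (simp add: p_def)
    finally have eq: "word_elt M (s # q @ r) = word_elt M (s # u)" .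
    have "reduced M (s # q @ r)"
      using len q qr' st by (intro reduced_same_length[OF Suc.prems(1) _ eq]) auto
    then show ?thesis using eq alt by metis
  next
    case False
    then obtain r' where r: "p = q @ a # r'" "r = r' @ y"
      using qr(1) by (auto simp: append_eq_append_conv2 append_eq_Cons_conv Cons_eq_append_conv)
    \<comment> \<open>A deletion inside the prefix would shorten \<open>s # p\<close>, which is
      alternating with at most \<open>cox M s t\<close> letters and so reduced.\<close>
    have "word_elt M (s # p) = word_elt M (q @ r')"
      using qr(2) r qr' p st word_elt_right_cancel[of "s # p" y "q @ r'"] by simp
    moreover have "reduced M (s # p)"
      using reduced_alt_word[OF st(1,2) Suc.prems(4,5)] by (simp add: p_def)
    ultimately have "length (s # p) \<le> length (q @ r')"
      using reducedD[of "s # p" "q @ r'"] r qr' by simp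
    then show ?thesis using r(1) by simp
  qed
qed

text \<open>Words with the same head reduce to their tails. For different heads \<open>s\<close> and
  \<open>t\<close>, pass through two reduced words starting with \<open>p(s,t)\<close> and
  \<open>p(t,s)\<close>: they share their heads with \<open>u\<close> and \<open>v\<close> and
  differ by one braid move.\<close>

lemma matsumoto:
  assumes "reduced M u" "reduced M v" "word_elt M u = word_elt M v"
  shows "braid_step\<^sup>*\<^sup>* u v"
  using assms
proof (induction "length u" arbitrary: u v rule: less_induct)
  case less
  have len: "length u = length v" using less.prems by (rule reduced_length_eq)
  have same_head: "braid_step\<^sup>*\<^sup>* (a # x) (a # y)"
    if "reduced M (a # x)" "reduced M (a # y)" "word_elt M (a # x) = word_elt M (a # y)"
      "length (a # x) = length u" for a x y
  proof -
    have "word_elt M x = word_elt M y"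
      using word_elt_left_cancel[of "[a]" x y] that reduced_words by fastforce
    moreover have "reduced M x" "reduced M y"
      using that reduced_appendD(2)[of "[a]"] by simp_all
    ultimately show ?thesis
      using less.hyps[of x y] that(4) braid_steps_Cons by simp
  qed
  show ?case
  proof (cases u)
    case Nil
    then show ?thesis using len by simp
  next
    case (Cons s u')
    then obtain t v' where v: "v = t # v'" using len by (cases v) auto
    have gens: "s \<in> gens M" "t \<in> gens M"
      using less.prems(1,2) reduced_words v Cons by fastforce+
    show ?thesis
    proof (cases "s = t")
      case True
      then show ?thesis using same_head[of s u' v'] less.prems Cons v by simp
    next
      case False
      note su = less.prems(1)[unfolded Cons] and tv = less.prems(2)[unfolded v]
      note eq = less.prems(3)[unfolded Cons v]
      have "cox M s t \<noteq> \<infinity>"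
      proof
        assume "cox M s t = \<infinity>"
        \<comment> \<open>One letter more than \<open>u\<close>: the prefix alone exceeds the length
          of the element.\<close>
        then obtain x where x: "reduced M (alt_word (Suc (length u)) s t @ x)"
          "word_elt M (alt_word (Suc (length u)) s t @ x) = word_elt M (s # u')"
          using alternating_descents[OF su tv eq False, of "length u"] by auto
        then show False using reduced_length_eq[OF x(1) su x(2)] Cons by simp
      qed
      then obtain m where m: "cox M s t = enat m" by auto
      then obtain k where k: "m = Suc k"
        using cox_offdiag[OF gens False] by (cases m) (auto simp: numeral_eq_enat)
      obtain x where x: "reduced M (alt_word m s t @ x)"
        "word_elt M (alt_word m s t @ x) = word_elt M (s # u')"
        using alternating_descents[OF su tv eq False, of k] m k by auto
      have pair: "(s, t) \<in> finite_pairs M"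
        using gens False m by (simp add: finite_pairs_def)
      have xw: "x \<in> words" using x(1) reduced_words by fastforce
      have elt: "word_elt M (alt_word m s t @ x) = word_elt M (alt_word m t s @ x)"
        using alt_word_braid[OF gens m] xw gens
        by (intro word_elt_cong refl) (simp_all add: alt_word_in_words)
      have red: "reduced M (alt_word m t s @ x)"
        using xw gens elt by (intro reduced_same_length[OF x(1)]) (simp_all add: alt_word_in_words)
      have "braid_step\<^sup>*\<^sup>* u (alt_word m s t @ x)"
        using same_head[of s u' "alt_word k t s @ x"] su x k Cons by simp
      also have "braid_step (alt_word m s t @ x) (alt_word m t s @ x)"
        using braid_step.intros[OF pair, of m "[]" x] m by simp
      also have "braid_step\<^sup>*\<^sup>* (alt_word m t s @ x) v"
        using same_head[of t "alt_word k s t @ x" v'] tv red elt x(2) eq len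
          reduced_length_eq[OF red tv] k v by simp
      finally show ?thesis .
    qed
  qed
qed

text \<open>At the shortest non-reduced suffix \<open>a # w\<close>, exchange yields a second
  reduced word \<open>a # u @ v\<close> for \<open>w\<close>. Braid moves lead from \<open>w\<close>
  to it, and the letter in front then makes \<open>a a\<close>.\<close>

lemma not_reduced_braid:
  assumes "w \<in> words" "\<not> reduced M w"
  obtains u s v where "braid_step\<^sup>*\<^sup>* w (u @ s # s # v)"
proof -
  have "\<exists>u s v. braid_step\<^sup>*\<^sup>* w (u @ s # s # v)"
    using assms
  proof (induction w rule: list.induct)
    case Nil
    then show ?case using reduced_Nil by simp
  next
    case (Cons a w)
    then have aw: "a \<in> gens M" "w \<in> words" by simp_all
    show ?case
    proof (cases "reduced M w")
      case False
      then obtain u s v where "braid_step\<^sup>*\<^sup>* w (u @ s # s # v)" using Cons.IH aw by blast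
      then have "braid_step\<^sup>*\<^sup>* (a # w) ((a # u) @ s # s # v)"
        using braid_steps_Cons by fastforce
      then show ?thesis by blast
    next
      case True
      obtain u b v where uv: "w = u @ b # v" "word_elt M (a # w) = word_elt M (u @ v)"
        using exchange[OF True aw(1) Cons.prems(2)] by blast
      have uv_words: "u \<in> words" "v \<in> words" using aw(2) uv(1) by simp_all
      have "word_elt M (a # u @ v) = word_elt M (a # a # w)"
        using word_elt_cong[OF refl uv(2)[symmetric], of "[a]"] aw uv_words by simp
      then have eq: "word_elt M (a # u @ v) = word_elt M w"
        using word_elt_cancel[of a "[]" w] aw by simp
      then have "reduced M (a # u @ v)"
        using aw uv_words uv(1) by (intro reduced_same_length[OF True _ eq]) auto
      then have "braid_step\<^sup>*\<^sup>* w (a # u @ v)"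
        using matsumoto[OF True] eq by simp
      then have "braid_step\<^sup>*\<^sup>* (a # w) ([] @ a # a # u @ v)"
        using braid_steps_Cons by simp
      then show ?thesis by blast
    qed
  qed
  then show ?thesis using that by blast
qed


section \<open>Length and Bruhat order\<close>

definition cox_length :: "'s signed_word set \<Rightarrow> nat" where
  "cox_length x = (LEAST n. \<exists>w\<in>words. length w = n \<and> word_elt M w = x)"

lemma reduced_exists:
  assumes "x \<in> carrier (coxeter_group M)"
  obtains w where "reduced M w" "word_elt M w = x"
proof -
  obtain u where "u \<in> words \<and> word_elt M u = x"
    using coxeter_group_elt[OF assms] by metis
  then obtain w where "w \<in> words \<and> word_elt M w = x"
    "\<And>v. v \<in> words \<and> word_elt M v = x \<Longrightarrow> length w \<le> length v"
    using ex_has_least_nat[of "\<lambda>w. w \<in> words \<and> word_elt M w = x" u length] by blast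
  then show ?thesis using that reducedI by blast
qed

lemma cox_length_reduced:
  assumes "reduced M w"
  shows "cox_length (word_elt M w) = length w"
  unfolding cox_length_def
  using reducedD[OF assms] reduced_words[OF assms] by (intro Least_equality) auto

lemma cox_length_le: "w \<in> words \<Longrightarrow> cox_length (word_elt M w) \<le> length w"
  unfolding cox_length_def by (intro Least_le) auto

lemma cox_length_one: "cox_length \<one>\<^bsub>coxeter_group M\<^esub> = 0"
  using cox_length_reduced[OF reduced_Nil] by (simp add: word_elt_one)

lemma cox_length_gen: "s \<in> gens M \<Longrightarrow> cox_length (gen_elt M s) \<le> 1"
  using cox_length_le[of "[s]"] by simp

lemma cox_length_eq_0:
  assumes "x \<in> carrier (coxeter_group M)" "cox_length x = 0"
  shows "x = \<one>\<^bsub>coxeter_group M\<^esub>"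
  using assms by (metis cox_length_reduced length_0_conv reduced_exists word_elt_one)

lemma gen_elt_neq_one: "s \<in> gens M \<Longrightarrow> gen_elt M s \<noteq> \<one>\<^bsub>coxeter_group M\<^esub>"
  using word_elt_parity[of "[s]" "[]"] by (auto simp: word_elt_one)

text \<open>Every use of WG2 goes through this lemma: a subword of a reduced word is no longer than
  it, and equal length forces the whole word.\<close>

lemma bruhat_le_length:
  assumes "bruhat_le M u v"
  shows "cox_length u \<le> cox_length v" "cox_length u = cox_length v \<Longrightarrow> u = v"
proof -
  obtain x y where xy: "reduced M x" "word_elt M x = v" "subseq y x" "word_elt M y = u"
    using assms by (auto simp: bruhat_le_def)
  have "y \<in> words"
    using subseq_set_subset[OF xy(3)] reduced_words[OF xy(1)] by (auto simp: in_lists_conv_set)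
  then have u: "cox_length u \<le> length y" using cox_length_le xy(4) by blast
  have v: "cox_length v = length x" using cox_length_reduced xy(1,2) by blast
  have len: "length y \<le> length x" using xy(3) by (rule list_emb_length)
  show "cox_length u \<le> cox_length v" using u v len by simp
  show "u = v" if "cox_length u = cox_length v"
  proof -
    have "length y = length x" using u v len that by simp
    then have "y = x" using xy(3) by (rule subseq_same_length[rotated])
    then show ?thesis using xy by simp
  qed
qed

lemma bruhat_le_one:
  assumes "bruhat_le M u \<one>\<^bsub>coxeter_group M\<^esub>"
  shows "u = \<one>\<^bsub>coxeter_group M\<^esub>"
  using bruhat_le_length[OF assms] by (simp add: cox_length_one)

lemma bruhat_le_gen:
  assumes "bruhat_le M u (gen_elt M s)" "s \<in> gens M" "u \<in> carrier (coxeter_group M)"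
  shows "u \<in> {\<one>\<^bsub>coxeter_group M\<^esub>, gen_elt M s}"
  using bruhat_le_length[OF assms(1)] cox_length_gen[OF assms(2)] cox_length_eq_0[OF assms(3)]
  by fastforce

lemma gen_elt_closed: "s \<in> gens M \<Longrightarrow> gen_elt M s \<in> carrier (coxeter_group M)"
  by (simp add: word_elt_closed)

lemma gen_elt_square:
  "s \<in> gens M \<Longrightarrow> gen_elt M s \<otimes>\<^bsub>coxeter_group M\<^esub> gen_elt M s = \<one>\<^bsub>coxeter_group M\<^esub>"
  by (simp add: word_elt_mult word_elt_double word_elt_one)

lemma mult_gen_gen:
  assumes "x \<in> carrier (coxeter_group M)" "s \<in> gens M"
  shows "x \<otimes>\<^bsub>coxeter_group M\<^esub> gen_elt M s \<otimes>\<^bsub>coxeter_group M\<^esub> gen_elt M s = x"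
proof -
  interpret group "coxeter_group M" by (rule group_coxeter_group)
  show ?thesis using assms by (simp add: m_assoc gen_elt_closed gen_elt_square)
qed

text \<open>The lengths differ by at most one, and by parity they are not equal.\<close>

lemma cox_length_mult_gen:
  assumes "x \<in> carrier (coxeter_group M)" "s \<in> gens M"
  shows "cox_length (x \<otimes>\<^bsub>coxeter_group M\<^esub> gen_elt M s) = cox_length x + 1 \<or>
    cox_length x = cox_length (x \<otimes>\<^bsub>coxeter_group M\<^esub> gen_elt M s) + 1"
proof -
  obtain w where w: "reduced M w" "word_elt M w = x" using reduced_exists[OF assms(1)] .
  have ww: "w \<in> words" using w(1) by (rule reduced_words)
  have xs: "x \<otimes>\<^bsub>coxeter_group M\<^esub> gen_elt M s = word_elt M (w @ [s])"
    using word_elt_mult[of w "[s]"] w(2) ww assms(2) by simp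
  then obtain v where v: "reduced M v" "word_elt M v = word_elt M (w @ [s])"
    using reduced_exists[OF word_elt_closed, of "w @ [s]"] ww assms(2) by auto
  have vw: "v \<in> words" using v(1) by (rule reduced_words)
  have len: "cox_length x = length w" "cox_length (word_elt M (w @ [s])) = length v"
    using cox_length_reduced[OF w(1)] cox_length_reduced[OF v(1)] w(2) v(2) by simp_all
  have "word_elt M (v @ [s]) = word_elt M ((w @ [s]) @ [s])"
    using word_elt_cong[OF v(2), of "[s]" "[s]"] vw ww assms(2) by simp
  then have "word_elt M (v @ [s]) = x"
    using word_elt_cancel[of s w "[]"] ww assms(2) w(2) by simp
  then have "length w \<le> length v + 1"
    using reducedD[OF w(1), of "v @ [s]"] w(2) vw assms(2) by simp
  moreover have "length v \<le> length w + 1"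
    using reducedD[OF v(1), of "w @ [s]"] v(2) ww assms(2) by simp
  moreover have "even (length v) \<longleftrightarrow> even (length w + 1)"
    using word_elt_parity[OF v(2)] vw ww assms(2) by simp
  ultimately have "length v = length w + 1 \<or> length w = length v + 1" by presburger
  then show ?thesis using xs len by simp
qed

text \<open>Turns a drop in length into the hypothesis of WG3: \<open>x\<close> has a reduced word
  ending in \<open>s\<close>, and omitting that letter gives the subword.\<close>

lemma bruhat_lessI:
  assumes "x \<in> carrier (coxeter_group M)" "s \<in> gens M"
    and less: "cox_length (x \<otimes>\<^bsub>coxeter_group M\<^esub> gen_elt M s) < cox_length x"
  shows "bruhat_less M (x \<otimes>\<^bsub>coxeter_group M\<^esub> gen_elt M s) x"
proof -
  interpret group "coxeter_group M" by (rule group_coxeter_group)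
  obtain v where v: "reduced M v" "word_elt M v = x \<otimes>\<^bsub>coxeter_group M\<^esub> gen_elt M s"
    using reduced_exists[OF m_closed[OF assms(1) gen_elt_closed[OF assms(2)]]] .
  have vw: "v \<in> words" using v(1) by (rule reduced_words)
  have vs: "word_elt M (v @ [s]) = x"
    using mult_gen_gen[OF assms(1,2)] word_elt_mult[of v "[s]"] v(2) vw assms(2) by simp
  obtain w where w: "reduced M w" "word_elt M w = x" using reduced_exists[OF assms(1)] .
  have "length w = length v + 1"
    using cox_length_reduced[OF w(1)] cox_length_reduced[OF v(1)] v(2) w(2) less
      cox_length_mult_gen[OF assms(1,2)] by simp
  then have "reduced M (v @ [s])"
    using vs w vw assms(2) by (intro reduced_same_length[OF w(1)]) auto
  moreover have "subseq v (v @ [s])"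
    by (rule prefix_imp_subseq) simp
  ultimately have "bruhat_le M (x \<otimes>\<^bsub>coxeter_group M\<^esub> gen_elt M s) x"
    unfolding bruhat_le_def using vs v(2) by blast
  then show ?thesis using less by (auto simp: bruhat_less_def)
qed

end


section \<open>Inverses in groupoids\<close>

context groupoid
begin

lemma is_inverse_unique:
  assumes "g \<in> edges G" "is_inverse G g h" "is_inverse G g k"
  shows "h = k"
proof -
  have h: "h \<in> edges G" "ini G h = ter G g" "ter G h = ini G g" "cmp G h g = idn G (ter G g)"
    and k: "k \<in> edges G" "ini G k = ter G g" "cmp G g k = idn G (ini G g)"
    using assms by (simp_all add: is_inverse_def)
  have "h = cmp G h (cmp G g k)" using cmp_idn[of h] h k by simp
  also have "\<dots> = cmp G (cmp G h g) k" using cmp_assoc[of h g k] assms(1) h k by simp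
  also have "\<dots> = k" using idn_cmp[of k] h k by simp
  finally show ?thesis .
qed

lemma inverse_edge_eq: "g \<in> edges G \<Longrightarrow> is_inverse G g h \<Longrightarrow> inverse_edge G g = h"
  unfolding inverse_edge_def using is_inverse_unique by blast

lemma is_inverse_inverse_edge: "g \<in> edges G \<Longrightarrow> is_inverse G g (inverse_edge G g)"
  using inverse_ex inverse_edge_eq by metis

lemma inverse_edge_closed [simp]: "g \<in> edges G \<Longrightarrow> inverse_edge G g \<in> edges G"
  and ini_inverse_edge [simp]: "g \<in> edges G \<Longrightarrow> ini G (inverse_edge G g) = ter G g"
  and ter_inverse_edge [simp]: "g \<in> edges G \<Longrightarrow> ter G (inverse_edge G g) = ini G g"
  and cmp_inverse_edge: "g \<in> edges G \<Longrightarrow> cmp G g (inverse_edge G g) = idn G (ini G g)"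
  and inverse_edge_cmp: "g \<in> edges G \<Longrightarrow> cmp G (inverse_edge G g) g = idn G (ter G g)"
  using is_inverse_inverse_edge[of g] by (simp_all add: is_inverse_def)

lemma inverse_edge_inverse_edge [simp]: "g \<in> edges G \<Longrightarrow> inverse_edge G (inverse_edge G g) = g"
  by (rule inverse_edge_eq) (simp_all add: is_inverse_def cmp_inverse_edge inverse_edge_cmp)

lemma cmp_cancel_left:
  "g \<in> edges G \<Longrightarrow> h \<in> edges G \<Longrightarrow> ter G g = ini G h \<Longrightarrow> cmp G (inverse_edge G g) (cmp G g h) = h"
  using cmp_assoc[of "inverse_edge G g" g h] idn_cmp[of h] by (simp add: inverse_edge_cmp)

lemma cmp_cancel_left':
  "g \<in> edges G \<Longrightarrow> h \<in> edges G \<Longrightarrow> ini G g = ini G h \<Longrightarrow> cmp G g (cmp G (inverse_edge G g) h) = h"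
  using cmp_assoc[of g "inverse_edge G g" h] idn_cmp[of h] by (simp add: cmp_inverse_edge)

lemma cmp_cancel_right:
  "g \<in> edges G \<Longrightarrow> h \<in> edges G \<Longrightarrow> ter G g = ini G h \<Longrightarrow> cmp G (cmp G g h) (inverse_edge G h) = g"
  using cmp_assoc[of g h "inverse_edge G h"] cmp_idn[of g] by (simp add: cmp_inverse_edge)

lemma inverse_edge_idn: "C \<in> verts G \<Longrightarrow> inverse_edge G (idn G C) = idn G C"
  using idn_cmp[of "idn G C"]
  by (intro inverse_edge_eq) (simp_all add: is_inverse_def idn_closed ini_idn ter_idn)

lemma inverse_edge_eq_idn:
  assumes "g \<in> edges G" "inverse_edge G g = idn G C" "C \<in> verts G"
  shows "g = idn G C"
  using assms inverse_edge_idn inverse_edge_inverse_edge by metis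

end


section \<open>Homotopy of galleries\<close>

lemma path_end_append: "path_end W C (xs @ ys) = path_end W (path_end W C xs) ys"
  by (induction xs arbitrary: C) auto

lemma is_path_ini: "is_path M W C xs \<Longrightarrow> C \<in> chambers W"
  by (cases xs) auto

lemma is_path_append:
  "is_path M W C (xs @ ys) \<longleftrightarrow> is_path M W C xs \<and> is_path M W (path_end W C xs) ys"
  by (induction xs arbitrary: C) (auto dest: is_path_ini)

lemma is_path_type: "is_path M W C xs \<Longrightarrow> map fst xs \<in> lists (gens M)"
proof (induction xs arbitrary: C)
  case (Cons x xs)
  then show ?case
    using Cons.IH[of "ter (panel_gpd W (fst x)) (snd x)"] by (cases x) simp
qed simp

lemma homotopy_rel_refl: "\<beta> \<in> galleries M W \<Longrightarrow> (\<beta>, \<beta>) \<in> homotopy_rel M W"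
  by (simp add: homotopy_rel_def)

lemma homotopy_rel_sym: "(\<beta>, \<gamma>) \<in> homotopy_rel M W \<Longrightarrow> (\<gamma>, \<beta>) \<in> homotopy_rel M W"
  by (auto simp: homotopy_rel_def intro: equivclp_sym)

lemma homotopy_rel_trans:
  "(\<beta>, \<gamma>) \<in> homotopy_rel M W \<Longrightarrow> (\<gamma>, \<zeta>) \<in> homotopy_rel M W \<Longrightarrow> (\<beta>, \<zeta>) \<in> homotopy_rel M W"
  by (auto simp: homotopy_rel_def intro: equivclp_trans)

fun rev_path :: "('s, 'v, 'e, 'z) chamber_system_scheme \<Rightarrow> ('s \<times> 'e) list \<Rightarrow> ('s \<times> 'e) list" where
  "rev_path W [] = []"
| "rev_path W ((s, e) # xs) = rev_path W xs @ [(s, inverse_edge (panel_gpd W s) e)]"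

lemma map_fst_rev_path: "map fst (rev_path W xs) = rev (map fst xs)"
  by (induction W xs rule: rev_path.induct) auto

context chamber_system
begin

lemma is_path_rev_path:
  assumes "is_path M W C xs"
  shows "is_path M W (path_end W C xs) (rev_path W xs) \<and> path_end W (path_end W C xs) (rev_path W xs) = C"
  using assms
proof (induction xs arbitrary: C)
  case (Cons x xs)
  obtain s e where x: "x = (s, e)" by (cases x)
  have e: "C \<in> chambers W" "s \<in> gens M" "e \<in> edges (panel_gpd W s)" "ini (panel_gpd W s) e = C"
    "e \<noteq> idn (panel_gpd W s) C" "is_path M W (ter (panel_gpd W s) e) xs"
    using Cons.prems by (simp_all add: x)
  interpret P: groupoid "panel_gpd W s" using e(2) by (rule panel_groupoid)
  have "inverse_edge (panel_gpd W s) e \<noteq> idn (panel_gpd W s) (ter (panel_gpd W s) e)"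
  proof
    assume *: "inverse_edge (panel_gpd W s) e = idn (panel_gpd W s) (ter (panel_gpd W s) e)"
    then have "e = idn (panel_gpd W s) (ter (panel_gpd W s) e)"
      using P.inverse_edge_eq_idn e P.ter_closed by blast
    moreover from this have "ter (panel_gpd W s) e = C"
      using e(3,4) P.ini_idn P.ter_closed by metis
    ultimately show False using e(5) by simp
  qed
  then show ?case
    using Cons.IH[OF e(6)] e P.ter_closed[of e] panel_verts[OF e(2)]
    by (simp add: x is_path_append path_end_append)
qed simp

end

context weyl_data
begin

text \<open>The definition only asks the source of a move to be a gallery. This adds that the target
  is one too, and that the two exchanged segments end at the same chamber.\<close>

lemma elementary_homotopy_cases_local:
  assumes "elementary_homotopy M W \<beta> \<beta>'"
  obtains C us p q vs where "\<beta> = (C, us @ p @ vs)" "\<beta>' = (C, us @ q @ vs)"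
    "is_path M W C (us @ p @ vs)" "is_path M W C (us @ q @ vs)"
    "path_end W (path_end W C us) p = path_end W (path_end W C us) q"
  using assms
proof (cases rule: elementary_homotopy.cases)
  case (delete_inverse C us s i vs)
  let ?i' = "inverse_edge (panel_gpd W s) i"
  have p: "is_path M W C (us @ [(s, i), (s, ?i')] @ vs)"
    using delete_inverse by (simp add: galleries_def)
  then have i: "s \<in> gens M" "i \<in> edges (panel_gpd W s)" "ini (panel_gpd W s) i = path_end W C us"
    by (simp_all add: is_path_append)
  interpret P: groupoid "panel_gpd W s" using i(1) by (rule panel_groupoid)
  show ?thesis
    using that[of C us "[(s, i), (s, ?i')]" vs "[]"] delete_inverse p i
    by (simp add: is_path_append is_path_ini)
next
  case (compose C us s i j vs)
  have p: "is_path M W C (us @ [(s, i), (s, j)] @ vs)"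
    using compose by (simp add: galleries_def)
  then have ij: "s \<in> gens M" "i \<in> edges (panel_gpd W s)" "ini (panel_gpd W s) i = path_end W C us"
    "j \<in> edges (panel_gpd W s)" "ini (panel_gpd W s) j = ter (panel_gpd W s) i"
    by (simp_all add: is_path_append)
  interpret P: groupoid "panel_gpd W s" using ij(1) by (rule panel_groupoid)
  \<comment> \<open>Edges of galleries are non-identities; the composed edge is one because
    \<open>j\<close> is not the inverse of \<open>i\<close>.\<close>
  have "cmp (panel_gpd W s) i j \<noteq> idn (panel_gpd W s) (path_end W C us)"
  proof
    assume "cmp (panel_gpd W s) i j = idn (panel_gpd W s) (path_end W C us)"
    then have "cmp (panel_gpd W s) (inverse_edge (panel_gpd W s) i) (idn (panel_gpd W s) (ini (panel_gpd W s) i)) = j"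
      using P.cmp_cancel_left[of i j] ij by simp
    then show False
      using P.cmp_idn[of "inverse_edge (panel_gpd W s) i"] ij compose(4) by simp
  qed
  then show ?thesis
    using that[of C us "[(s, i), (s, j)]" vs "[(s, cmp (panel_gpd W s) i j)]"] compose p ij
    by (simp add: is_path_append P.cmp_closed P.ini_cmp P.ter_cmp)
next
  case (delete_suite C us xs vs s t)
  have p: "is_path M W C (us @ xs @ vs)"
    using delete_suite by (simp add: galleries_def)
  have "path_end W (path_end W C us) xs = path_end W C us"
    using suites_cycles[of s t] delete_suite by (auto simp: st_cycles_def gal_ini_def gal_ter_def)
  then show ?thesis
    using that[of C us xs vs "[]"] delete_suite p by (simp add: is_path_append)
qed

lemma elementary_homotopy_path:
  assumes "elementary_homotopy M W (C, xs) (C', ys)"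
  shows "C' = C" "is_path M W C xs" "is_path M W C ys" "path_end W C xs = path_end W C ys"
  using assms by (auto elim!: elementary_homotopy_cases_local simp: path_end_append)

lemma elementary_homotopy_context:
  assumes "elementary_homotopy M W (C, xs) (C, ys)" "is_path M W D (us @ xs @ vs)" "path_end W D us = C"
  shows "elementary_homotopy M W (D, us @ xs @ vs) (D, us @ ys @ vs)"
  using assms(1)
proof (cases rule: elementary_homotopy.cases)
  case (delete_inverse us' s i vs')
  then show ?thesis
    using elementary_homotopy.delete_inverse[of D "us @ us'" s i W "vs' @ vs" M] assms(2)
    by (simp add: galleries_def)
next
  case (compose us' s i j vs')
  then show ?thesis
    using elementary_homotopy.compose[of D "us @ us'" s i j "vs' @ vs" M W] assms(2)
    by (simp add: galleries_def)
next
  case (delete_suite us' zs vs' s t)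
  then show ?thesis
    using elementary_homotopy.delete_suite[of D "us @ us'" zs "vs' @ vs" M W s t] assms(2,3)
    by (simp add: galleries_def gal_ter_def path_end_append)
qed

text \<open>The target \<open>\<beta>\<close> is left general because the intermediate galleries of
  a homotopy are not known in advance to start at \<open>C\<close>; this is proved along the
  way.\<close>

lemma homotopy_context:
  assumes "equivclp (elementary_homotopy M W) (C, xs) \<beta>"
    "is_path M W D (us @ xs @ vs)" "path_end W D us = C"
  shows "\<exists>ys. \<beta> = (C, ys) \<and> ((D, us @ xs @ vs), (D, us @ ys @ vs)) \<in> homotopy_rel M W"
proof -
  have "\<exists>ys. \<beta> = (C, ys) \<and> is_path M W D (us @ ys @ vs) \<and>
    equivclp (elementary_homotopy M W) (D, us @ xs @ vs) (D, us @ ys @ vs)"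
    using assms(1)
  proof (induction rule: equivclp_induct)
    case base
    then show ?case using assms(2) by simp
  next
    case (step \<beta> \<gamma>)
    then obtain ys where ys: "\<beta> = (C, ys)" "is_path M W D (us @ ys @ vs)"
      "equivclp (elementary_homotopy M W) (D, us @ xs @ vs) (D, us @ ys @ vs)" by blast
    obtain C' zs where \<gamma>: "\<gamma> = (C', zs)" by (cases \<gamma>)
    have C': "C' = C" and zs: "is_path M W C zs" "path_end W C zs = path_end W C ys"
      using step(2) elementary_homotopy_path[of C ys C' zs] elementary_homotopy_path[of C' zs C ys]
      by (auto simp: ys(1) \<gamma>)
    have path: "is_path M W D (us @ zs @ vs)"
      using ys(2) zs assms(3) by (simp add: is_path_append)
    have "elementary_homotopy M W (D, us @ ys @ vs) (D, us @ zs @ vs) \<or>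
        elementary_homotopy M W (D, us @ zs @ vs) (D, us @ ys @ vs)"
      using step(2) elementary_homotopy_context[OF _ _ assms(3)] path ys(2) by (auto simp: ys(1) \<gamma> C')
    then have "equivclp (elementary_homotopy M W) (D, us @ ys @ vs) (D, us @ zs @ vs)"
      using r_into_equivclp equivclp_sym by metis
    with ys(3) have "equivclp (elementary_homotopy M W) (D, us @ xs @ vs) (D, us @ zs @ vs)"
      by (rule equivclp_trans)
    then show ?case using \<gamma> C' path by simp
  qed
  then show ?thesis using assms(2) by (auto simp: homotopy_rel_def galleries_def)
qed

lemma elementary_homotopy_rel:
  assumes "elementary_homotopy M W (C, xs) (C, ys)"
  shows "((C, xs), (C, ys)) \<in> homotopy_rel M W"
  using assms elementary_homotopy_path[OF assms] by (auto simp: homotopy_rel_def galleries_def)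

text \<open>The pair in the middle goes first. The move deletes an edge followed by its inverse, so
  it is applied to \<open>?e'\<close>, whose inverse is \<open>e\<close>.\<close>

lemma rev_path_cancel:
  assumes "is_path M W C (us @ rev_path W xs @ xs)"
  shows "((C, us @ rev_path W xs @ xs), (C, us)) \<in> homotopy_rel M W"
  using assms
proof (induction xs arbitrary: us rule: list.induct)
  case Nil
  then show ?case by (simp add: homotopy_rel_refl galleries_def)
next
  case (Cons x xs)
  obtain s e where x: "x = (s, e)" by (cases x)
  let ?e' = "inverse_edge (panel_gpd W s) e"
  have eq: "us @ rev_path W (x # xs) @ x # xs = (us @ rev_path W xs) @ [(s, ?e'), (s, e)] @ xs"
    by (simp add: x)
  have e: "s \<in> gens M" "e \<in> edges (panel_gpd W s)"
    using Cons.prems by (simp_all add: x is_path_append)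
  interpret P: groupoid "panel_gpd W s" using e(1) by (rule panel_groupoid)
  have "elementary_homotopy M W (C, (us @ rev_path W xs) @ [(s, ?e'), (s, e)] @ xs)
      (C, (us @ rev_path W xs) @ xs)"
    using elementary_homotopy.delete_inverse[of C "us @ rev_path W xs" s ?e' W xs M] Cons.prems e
    unfolding eq by (simp add: galleries_def)
  note step = elementary_homotopy_rel[OF this] elementary_homotopy_path(3)[OF this]
  show ?case
    using homotopy_rel_trans[OF step(1)] Cons.IH step(2) unfolding eq by simp
qed

end

section \<open>Braid moves on galleries and the existence of geodesics\<close>

context pre_weyl_graph
begin

text \<open>PW1, applied to the segment of the gallery over the braid word, lifts the move. That
  \<open>M\<close> is a Coxeter matrix is an explicit premise because the locales of Weyl data do
  not contain it.\<close>

lemma braid_homotopy: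
  assumes cox: "coxeter_matrix M"
    and "coxeter_matrix.braid_step M w w'" "is_path M W C xs" "map fst xs = w"
  shows "\<exists>ys. ((C, xs), (C, ys)) \<in> homotopy_rel M W \<and> map fst ys = w'"
  using assms(2)
proof (cases rule: coxeter_matrix.braid_step.cases[OF cox, consumes 1])
  case (1 s t m u v)
  obtain us rest where us: "xs = us @ rest" "u = map fst us" "alt_word m s t @ v = map fst rest"
    using assms(4)[unfolded 1(1)] unfolding map_eq_append_conv by blast
  obtain ps vs where ps: "rest = ps @ vs" "alt_word m s t = map fst ps" "v = map fst vs"
    using us(3)[symmetric] unfolding map_eq_append_conv by blast
  have xs: "xs = us @ ps @ vs" "map fst us = u" "map fst ps = alt_word m s t" "map fst vs = v"
    using us ps by simp_all
  let ?D = "path_end W C us"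
  have "(?D, ps) \<in> max_geodesics M W s t"
    using assms(3) xs 1 by (simp add: max_geodesics_def galleries_def gal_type_def is_path_append)
  then obtain \<gamma> where \<gamma>: "\<gamma> \<in> max_geodesics M W t s" "((?D, ps), \<gamma>) \<in> homotopy_rel M W"
    using PW1[OF 1(3)] by blast
  obtain qs where qs: "\<gamma> = (?D, qs)" "((C, us @ ps @ vs), (C, us @ qs @ vs)) \<in> homotopy_rel M W"
    using homotopy_context[of ?D ps \<gamma> C us vs] \<gamma>(2) assms(3) xs(1)
    by (auto simp: homotopy_rel_def)
  have "cox M t s = cox M s t"
    using coxeter_matrix.cox_sym[OF cox] 1(3) by (auto simp: finite_pairs_def)
  then have "map fst (us @ qs @ vs) = w'"
    using \<gamma>(1) 1 xs qs(1) by (simp add: max_geodesics_def gal_type_def)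
  then show ?thesis using qs(2) xs(1) by blast
qed

lemma braid_steps_homotopy:
  assumes cox: "coxeter_matrix M"
    and "(coxeter_matrix.braid_step M)\<^sup>*\<^sup>* (map fst xs) w" "is_path M W C xs"
  shows "\<exists>ys. ((C, xs), (C, ys)) \<in> homotopy_rel M W \<and> map fst ys = w"
  using assms(2)
proof (induction rule: rtranclp_induct)
  case base
  then show ?case
    using assms(3) by (intro exI[of _ xs]) (simp add: homotopy_rel_refl galleries_def)
next
  case (step w w')
  then obtain ys where ys: "((C, xs), (C, ys)) \<in> homotopy_rel M W" "map fst ys = w" by blast
  then have "is_path M W C ys" by (simp add: homotopy_rel_def galleries_def)
  then obtain zs where "((C, ys), (C, zs)) \<in> homotopy_rel M W" "map fst zs = w'"
    using braid_homotopy[OF cox step(2)] ys(2) by blast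
  then show ?case using ys(1) homotopy_rel_trans by blast
qed

text \<open>Braid moves keep the length and bring two edges of the same type together; deleting or
  composing these shortens the gallery by two edges or one.\<close>

lemma homotopic_geodesic:
  assumes cox: "coxeter_matrix M" and "is_path M W C xs"
  shows "\<exists>ys. ((C, xs), (C, ys)) \<in> homotopy_rel M W \<and> reduced M (map fst ys)"
  using assms(2)
proof (induction "length xs" arbitrary: xs rule: less_induct)
  case less
  interpret coxeter_matrix M by (rule cox)
  show ?case
  proof (cases "reduced M (map fst xs)")
    case True
    then show ?thesis
      using less.prems by (intro exI[of _ xs]) (simp add: homotopy_rel_refl galleries_def)
  next
    case False
    obtain u s v where braid: "braid_step\<^sup>*\<^sup>* (map fst xs) (u @ s # s # v)"
      using not_reduced_braid is_path_type[OF less.prems] False by blast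
    then obtain ys where ys: "((C, xs), (C, ys)) \<in> homotopy_rel M W" "map fst ys = u @ [s, s] @ v"
      using braid_steps_homotopy[OF cox braid less.prems] by auto
    then obtain us i j vs where split: "ys = us @ [(s, i), (s, j)] @ vs"
      by (auto simp: map_eq_append_conv map_eq_Cons_conv)
    have path: "(C, us @ [(s, i), (s, j)] @ vs) \<in> galleries M W"
      using ys(1) split by (simp add: homotopy_rel_def)
    have "length w = length (map fst xs)" if "braid_step\<^sup>*\<^sup>* (map fst xs) w" for w
      using that by (induction rule: rtranclp_induct) (auto elim: braid_step.cases)
    from this[OF braid] have len: "length xs = length us + length vs + 2"
      using arg_cong[OF ys(2), of length] split by simp
    obtain zs where zs: "elementary_homotopy M W (C, ys) (C, zs)" "length zs < length xs"
    proof (cases "j = inverse_edge (panel_gpd W s) i")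
      case True
      then show ?thesis
        using that[of "us @ vs"] elementary_homotopy.delete_inverse[of C us s i W vs M] path split len
        by simp
    next
      case False
      then show ?thesis
        using that[of "us @ [(s, cmp (panel_gpd W s) i j)] @ vs"]
          elementary_homotopy.compose[OF path False] split len by simp
    qed
    then obtain qs where "((C, zs), (C, qs)) \<in> homotopy_rel M W" "reduced M (map fst qs)"
      using less.hyps[of zs] elementary_homotopy_path(3)[OF zs(1)] by blast
    then show ?thesis
      using homotopy_rel_trans ys(1) elementary_homotopy_rel[OF zs(1)] by meson
  qed
qed

end


section \<open>The Weyl data of a strict W-groupoid\<close>

text \<open>\<open>H\<close> is not assumed to be a groupoid: its axioms are carried over from
  \<open>G\<close> along the bijections. This avoids working with the set-valued operations of the
  fundamental groupoid.\<close>

lemma groupoid_transport: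
  assumes G: "groupoid G" and bij0: "bij_betw \<psi>\<^sub>0 (verts G) (verts H)"
    and bij: "bij_betw \<psi> (edges G) (edges H)"
    and ends: "\<And>g. g \<in> edges G \<Longrightarrow> ini H (\<psi> g) = \<psi>\<^sub>0 (ini G g)"
      "\<And>g. g \<in> edges G \<Longrightarrow> ter H (\<psi> g) = \<psi>\<^sub>0 (ter G g)"
    and idn: "\<And>C. C \<in> verts G \<Longrightarrow> \<psi> (idn G C) = idn H (\<psi>\<^sub>0 C)"
    and cmp: "\<And>g h. g \<in> edges G \<Longrightarrow> h \<in> edges G \<Longrightarrow> ter G g = ini G h \<Longrightarrow>
      \<psi> (cmp G g h) = cmp H (\<psi> g) (\<psi> h)"
  shows "groupoid_iso G H \<psi>\<^sub>0 \<psi>"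
proof -
  interpret G: groupoid G by (rule G)
  note closed = G.ini_closed G.ter_closed G.idn_closed G.cmp_closed
    G.ini_idn G.ter_idn G.ini_cmp G.ter_cmp
  have verts: "\<psi>\<^sub>0 C \<in> verts H" if "C \<in> verts G" for C
    using bij0 that by (rule bij_betwE[rule_format])
  have edges: "\<psi> g \<in> edges H" if "g \<in> edges G" for g
    using bij that by (rule bij_betwE[rule_format])
  have vertE: "\<exists>C'\<in>verts G. C = \<psi>\<^sub>0 C'" if "C \<in> verts H" for C
    using bij0 that by (auto simp: bij_betw_def)
  have edgeE: "\<exists>g'\<in>edges G. g = \<psi> g'" if "g \<in> edges H" for g
    using bij that by (auto simp: bij_betw_def)
  have inj0: "C = D" if "\<psi>\<^sub>0 C = \<psi>\<^sub>0 D" "C \<in> verts G" "D \<in> verts G" for C D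
    using bij0 that by (auto simp: bij_betw_def dest: inj_onD)
  have adj: "ter G g = ini G h" if "ter H (\<psi> g) = ini H (\<psi> h)" "g \<in> edges G" "h \<in> edges G" for g h
    using that ends inj0 closed(1,2) by simp
  have "groupoid H"
  proof
    show "verts H \<noteq> {}" using G.nonempty verts by blast
  next
    fix C assume "C \<in> verts H"
    then obtain C' where C': "C' \<in> verts G" "C = \<psi>\<^sub>0 C'" using vertE by blast
    have eq: "idn H C = \<psi> (idn G C')" using C' idn by simp
    show "idn H C \<in> edges H" unfolding eq using C' closed edges by simp
    show "ini H (idn H C) = C" unfolding eq using C' ends closed by simp
    show "ter H (idn H C) = C" unfolding eq using C' ends closed by simp
  next
    fix g assume "g \<in> edges H"
    then obtain g' where g': "g' \<in> edges G" "g = \<psi> g'" using edgeE by blast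
    show "ini H g \<in> verts H" "ter H g \<in> verts H"
      using g' ends verts closed by simp_all
    have idns: "idn H (ini H g) = \<psi> (idn G (ini G g'))" "idn H (ter H g) = \<psi> (idn G (ter G g'))"
      using g' ends idn closed by simp_all
    have "cmp H (\<psi> (idn G (ini G g'))) (\<psi> g') = \<psi> (cmp G (idn G (ini G g')) g')"
      by (rule cmp[symmetric]) (use g' closed in simp_all)
    then show "cmp H (idn H (ini H g)) g = g"
      using idns g' G.idn_cmp by simp
    have "cmp H (\<psi> g') (\<psi> (idn G (ter G g'))) = \<psi> (cmp G g' (idn G (ter G g')))"
      by (rule cmp[symmetric]) (use g' closed in simp_all)
    then show "cmp H g (idn H (ter H g)) = g"
      using idns g' G.cmp_idn by simp
    define k where "k = inverse_edge G g'"
    have k: "k \<in> edges G" "ini G k = ter G g'" "ter G k = ini G g'"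
      "cmp G g' k = idn G (ini G g')" "cmp G k g' = idn G (ter G g')"
      using g' by (simp_all add: k_def G.cmp_inverse_edge G.inverse_edge_cmp)
    have "is_inverse H g (\<psi> k)"
      unfolding is_inverse_def using k g' edges ends idns cmp[of g' k] cmp[of k g'] by simp
    then show "\<exists>h. is_inverse H g h" ..
  next
    fix g h assume gh: "g \<in> edges H" "h \<in> edges H" "ter H g = ini H h"
    then obtain g' h' where g': "g' \<in> edges G" "g = \<psi> g'" and h': "h' \<in> edges G" "h = \<psi> h'"
      using edgeE by metis
    have gh': "ter G g' = ini G h'" using adj gh(3) g' h' by simp
    have eq: "cmp H g h = \<psi> (cmp G g' h')" using cmp gh' g' h' by simp
    show "cmp H g h \<in> edges H" "ini H (cmp H g h) = ini H g" "ter H (cmp H g h) = ter H h"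
      unfolding eq using g' h' gh' edges ends closed by simp_all
    fix k assume k: "k \<in> edges H" "ter H h = ini H k"
    then obtain k' where k': "k' \<in> edges G" "k = \<psi> k'" using edgeE by blast
    have hk': "ter G h' = ini G k'" using adj k(2) h' k' by simp
    have "cmp H (\<psi> (cmp G g' h')) (\<psi> k') = \<psi> (cmp G (cmp G g' h') k')"
      by (rule cmp[symmetric]) (use g' h' k' gh' hk' closed in simp_all)
    also have "\<dots> = \<psi> (cmp G g' (cmp G h' k'))"
      using G.cmp_assoc g' h' k' gh' hk' by simp
    also have "\<dots> = cmp H (\<psi> g') (\<psi> (cmp G h' k'))"
      by (rule cmp) (use g' h' k' gh' hk' closed in simp_all)
    also have "\<psi> (cmp G h' k') = cmp H h k"
      using cmp hk' h' k' by simp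
    finally show "cmp H (cmp H g h) k = cmp H g (cmp H h k)" using eq g' k' by simp
  qed
  then show ?thesis
    unfolding groupoid_iso_def using G bij0 bij ends idn cmp by blast
qed

locale coxeter_W_groupoid = coxeter_matrix M + strict_W_groupoid M G \<delta>
  for M :: "'s coxeter_matrix" and G :: "('v, 'e) groupoid" and \<delta> :: "'e \<Rightarrow> 's signed_word set"
begin

abbreviation "cs \<equiv> associated_chamber_system M G \<delta>"
abbreviation "wd \<equiv> associated_weyl_data M G \<delta>"
abbreviation "par \<equiv> parabolic_groupoid M G \<delta>"
abbreviation mul (infixl "\<cdot>" 70) where "x \<cdot> y \<equiv> x \<otimes>\<^bsub>coxeter_group M\<^esub> y"
abbreviation unit ("\<e>") where "\<e> \<equiv> \<one>\<^bsub>coxeter_group M\<^esub>"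

lemma par_simps [simp]:
  "verts (par s) = verts G" "ini (par s) = ini G" "ter (par s) = ter G" "idn (par s) = idn G"
  "cmp (par s) = cmp G" "edges (par s) = {g \<in> edges G. \<delta> g \<in> {\<e>, gen_elt M s}}"
  by (simp_all add: parabolic_groupoid_def)

lemma wd_simps [simp]: "chambers wd = verts G" "panel_gpd wd = par"
  by (simp_all add: associated_weyl_data_def)

lemma cs_simps [simp]: "chambers cs = verts G" "panel_gpd cs = par"
  by (simp_all add: associated_chamber_system_def)

text \<open>The suites of \<open>wd\<close> are defined through cycles of the bare chamber system
  \<open>cs\<close>; these lemmas identify the galleries of the two.\<close>

lemma is_path_cs: "is_path M cs C xs \<longleftrightarrow> is_path M wd C xs"
  by (induction xs arbitrary: C) auto

lemma path_end_cs: "path_end cs C xs = path_end wd C xs"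
  by (induction xs arbitrary: C) auto

lemma st_cycles_cs: "st_cycles M cs s t = st_cycles M wd s t"
  by (simp add: st_cycles_def galleries_def gal_ter_def is_path_cs path_end_cs)

lemma suites_wd: "suites wd s t = {\<beta> \<in> st_cycles M wd s t. gal_composite G \<beta> = idn G (gal_ini \<beta>)}"
  unfolding st_cycles_cs[symmetric] by (simp add: associated_weyl_data_def)

text \<open>WG2 for \<open>g g^-1\<close> gives \<open>s \<delta>(g^-1) \<le> 1\<close>, and only
  \<open>1\<close> lies below \<open>1\<close>.\<close>

lemma delta_inverse_gen:
  assumes "g \<in> edges G" "s \<in> gens M" "\<delta> g = gen_elt M s"
  shows "\<delta> (inverse_edge G g) = gen_elt M s"
proof -
  interpret W: group "coxeter_group M" by (rule group_coxeter_group)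
  have "bruhat_le M (gen_elt M s \<cdot> \<delta> (inverse_edge G g)) \<e>"
    using WG2[of g "inverse_edge G g"] WG1[of "ini G g"] assms ini_closed
    by (simp add: cmp_inverse_edge)
  then have eq: "gen_elt M s \<cdot> \<delta> (inverse_edge G g) = \<e>"
    by (rule bruhat_le_one)
  have closed: "\<delta> (inverse_edge G g) \<in> carrier (coxeter_group M)"
    using assms(1) by (intro range) simp
  have "\<delta> (inverse_edge G g) = gen_elt M s \<cdot> gen_elt M s \<cdot> \<delta> (inverse_edge G g)"
    using gen_elt_square[OF assms(2)] closed by simp
  also have "\<dots> = gen_elt M s"
    using W.m_assoc[OF gen_elt_closed gen_elt_closed closed] eq assms(2) gen_elt_closed by simp
  finally show ?thesis .
qed

lemma inverse_edge_par_closed: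
  assumes "s \<in> gens M" "g \<in> edges (par s)"
  shows "inverse_edge G g \<in> edges (par s)"
proof (cases "\<delta> g = \<e>")
  case True
  then have "inverse_edge G g = g"
    using assms strict[of g] inverse_edge_idn[of "ini G g"] ini_closed[of g] by simp
  then show ?thesis using assms by simp
next
  case False
  then show ?thesis using assms delta_inverse_gen[of g s] by auto
qed

lemma cmp_par_closed:
  assumes s: "s \<in> gens M" and gh: "g \<in> edges (par s)" "h \<in> edges (par s)" "ter G g = ini G h"
  shows "cmp G g h \<in> edges (par s)"
proof -
  have edges: "g \<in> edges G" "h \<in> edges G" using gh by simp_all
  consider "\<delta> g = \<e>" | "\<delta> h = \<e>" | "\<delta> g = gen_elt M s" "\<delta> h = gen_elt M s"
    using gh by auto
  then show ?thesis
  proof cases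
    case 1
    then have "g = idn G (ini G h)"
      using strict edges gh(3) ter_idn ini_closed by metis
    then show ?thesis using gh(2) idn_cmp edges by metis
  next
    case 2
    then have "h = idn G (ter G g)"
      using strict edges gh(3) by metis
    then show ?thesis using gh(1) cmp_idn edges by metis
  next
    case 3
    let ?v = "\<delta> (cmp G g h)"
    have gh_edge: "cmp G g h \<in> edges G" using edges gh(3) by (rule cmp_closed)
    have v: "?v \<in> carrier (coxeter_group M)" using range[OF gh_edge] .
    \<comment> \<open>WG2 for \<open>g = (g h) h^-1\<close> puts \<open>?v s\<close> below
      \<open>s\<close>, so it is \<open>1\<close> or \<open>s\<close>; multiplying by
      \<open>s\<close> determines \<open>?v\<close> up to the same two values.\<close>
    have "bruhat_le M (?v \<cdot> gen_elt M s) (gen_elt M s)"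
      using WG2[of "cmp G g h" "inverse_edge G h"] cmp_cancel_right[of g h] delta_inverse_gen[of h s]
        edges gh(3) gh_edge s 3 by (simp add: ter_cmp)
    moreover have "?v \<cdot> gen_elt M s \<in> carrier (coxeter_group M)"
      using v gen_elt_closed[OF s] group_coxeter_group by (meson group.is_monoid monoid.m_closed)
    ultimately have "?v \<cdot> gen_elt M s \<in> {\<e>, gen_elt M s}"
      using bruhat_le_gen s by blast
    then have "?v \<cdot> gen_elt M s \<cdot> gen_elt M s \<in> {\<e> \<cdot> gen_elt M s, gen_elt M s \<cdot> gen_elt M s}"
      by auto
    moreover have "\<e> \<cdot> gen_elt M s = gen_elt M s"
      using group_coxeter_group gen_elt_closed[OF s] by (meson group.is_monoid monoid.l_one)
    ultimately have "?v \<in> {\<e>, gen_elt M s}"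
      unfolding mult_gen_gen[OF v s] using gen_elt_square[OF s] by auto
    then show ?thesis using gh_edge by simp
  qed
qed

lemma is_inverse_par:
  assumes "s \<in> gens M" "g \<in> edges (par s)"
  shows "is_inverse (par s) g (inverse_edge G g)"
  using is_inverse_inverse_edge[of g] inverse_edge_par_closed[OF assms] assms
  by (simp add: is_inverse_def)

lemma groupoid_par:
  assumes s: "s \<in> gens M"
  shows "groupoid (par s)"
proof
  fix g assume "g \<in> edges (par s)"
  then show "\<exists>h. is_inverse (par s) g h" using is_inverse_par[OF s] by blast
next
  fix g h assume "g \<in> edges (par s)" "h \<in> edges (par s)" "ter (par s) g = ini (par s) h"
  then show "cmp (par s) g h \<in> edges (par s)"
    using cmp_par_closed[OF s, of g h] by (simp only: par_simps(2,3,5))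
qed (auto simp: nonempty ini_closed ter_closed idn_closed WG1 ini_idn ter_idn ini_cmp ter_cmp
    idn_cmp cmp_idn cmp_assoc)

lemma inverse_edge_par:
  assumes "s \<in> gens M" "g \<in> edges (par s)"
  shows "inverse_edge (par s) g = inverse_edge G g"
  using groupoid.inverse_edge_eq[OF groupoid_par[OF assms(1)] assms(2) is_inverse_par[OF assms]] .

lemma weyl_data_wd: "weyl_data M wd"
proof (intro weyl_data.intro chamber_system.intro weyl_data_axioms.intro)
  show "groupoid (panel_gpd wd s)" if "s \<in> gens M" for s
    using groupoid_par[OF that] by simp
  show "verts (panel_gpd wd s) = chambers wd" for s by simp
  show "suites wd s t \<subseteq> st_cycles M wd s t" for s t by (auto simp: suites_wd)
qed

interpretation wd: weyl_data M wd
  by (rule weyl_data_wd)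

lemma delta_cmp_gen:
  assumes edges: "g \<in> edges G" "h \<in> edges G" "ter G g = ini G h"
    and s: "s \<in> gens M" "\<delta> h = gen_elt M s"
    and longer: "cox_length (\<delta> g) < cox_length (\<delta> g \<cdot> gen_elt M s)"
  shows "\<delta> (cmp G g h) = \<delta> g \<cdot> gen_elt M s"
proof -
  let ?v = "\<delta> (cmp G g h)"
  have gh: "cmp G g h \<in> edges G" using edges by (rule cmp_closed)
  have lower: "bruhat_le M (\<delta> g \<cdot> gen_elt M s) ?v"
    using WG2[OF edges] s by simp
  have upper: "bruhat_le M (?v \<cdot> gen_elt M s) (\<delta> g)"
    using WG2[of "cmp G g h" "inverse_edge G h"] cmp_cancel_right[of g h] delta_inverse_gen[of h s]
      edges gh s by (simp add: ter_cmp)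
  \<comment> \<open>With \<open>n\<close> the length of \<open>\<delta> g\<close>:
    \<open>lower\<close> gives at least \<open>n + 1\<close> for \<open>?v\<close>, while
    \<open>upper\<close> bounds \<open>?v s\<close> by \<open>n\<close> and hence \<open>?v\<close>
    by \<open>n + 1\<close>.\<close>
  have "cox_length (\<delta> g \<cdot> gen_elt M s) = cox_length ?v"
    using bruhat_le_length(1)[OF lower] bruhat_le_length(1)[OF upper] longer
      cox_length_mult_gen[OF range[OF edges(1)] s(1)] cox_length_mult_gen[OF range[OF gh] s(1)]
    by linarith
  then show ?thesis using bruhat_le_length(2)[OF lower] by simp
qed

lemma delta_edge:
  assumes "s \<in> gens M" "e \<in> edges (par s)" "e \<noteq> idn G (ini G e)"
  shows "\<delta> e = gen_elt M s"
  using assms strict[of e] by auto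


section \<open>Composites of galleries\<close>

lemma composite_Nil [simp]: "gal_composite G (C, []) = idn G C"
  by (simp add: gal_composite_def)

lemma composite_snoc: "gal_composite G (C, xs @ [(s, e)]) = cmp G (gal_composite G (C, xs)) e"
  by (simp add: gal_composite_def)

lemma composite_path:
  assumes "is_path M wd C xs"
  shows "gal_composite G (C, xs) \<in> edges G" "ini G (gal_composite G (C, xs)) = C"
    "ter G (gal_composite G (C, xs)) = path_end wd C xs"
proof -
  have "gal_composite G (C, xs) \<in> edges G \<and> ini G (gal_composite G (C, xs)) = C \<and>
    ter G (gal_composite G (C, xs)) = path_end wd C xs"
    using assms
  proof (induction xs rule: rev_induct)
    case Nil
    then show ?case by (simp add: idn_closed ini_idn ter_idn)
  next
    case (snoc x xs)
    then show ?case
      by (cases x) (simp add: is_path_append path_end_append composite_snoc cmp_closed ini_cmp ter_cmp)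
  qed
  then show "gal_composite G (C, xs) \<in> edges G" "ini G (gal_composite G (C, xs)) = C"
    "ter G (gal_composite G (C, xs)) = path_end wd C xs" by simp_all
qed

lemma composite_append:
  assumes "is_path M wd C (xs @ ys)"
  shows "gal_composite G (C, xs @ ys) =
    cmp G (gal_composite G (C, xs)) (gal_composite G (path_end wd C xs, ys))"
  using assms
proof (induction ys rule: rev_induct)
  case Nil
  then show ?case using cmp_idn[of "gal_composite G (C, xs)"] composite_path[of C xs] by simp
next
  case (snoc y ys)
  obtain s e where y: "y = (s, e)" by (cases y)
  have paths: "is_path M wd C xs" "is_path M wd (path_end wd C xs) ys" "is_path M wd C (xs @ ys)"
    and e: "e \<in> edges G" "ini G e = path_end wd (path_end wd C xs) ys"
    using snoc.prems by (auto simp: y is_path_append)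
  show ?case
    using snoc.IH[OF paths(3)] composite_path[OF paths(1)] composite_path[OF paths(2)] e
      cmp_assoc[of "gal_composite G (C, xs)" "gal_composite G (path_end wd C xs, ys)" e]
      composite_snoc[of C "xs @ ys" s e] composite_snoc[of "path_end wd C xs" ys s e]
    by (simp add: y)
qed

lemma composite_replace:
  assumes "is_path M wd C (us @ p @ vs)" "is_path M wd C (us @ q @ vs)"
    and "gal_composite G (path_end wd C us, p) = gal_composite G (path_end wd C us, q)"
    and "path_end wd (path_end wd C us) p = path_end wd (path_end wd C us) q"
  shows "gal_composite G (C, us @ p @ vs) = gal_composite G (C, us @ q @ vs)"
  using assms by (simp add: composite_append is_path_append)

lemma composite_elementary_homotopy:
  assumes "elementary_homotopy M wd \<beta> \<beta>'"
  shows "gal_composite G \<beta> = gal_composite G \<beta>'"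
  using assms
proof (cases rule: elementary_homotopy.cases)
  case (delete_inverse C us s i vs)
  let ?p = "[(s, i), (s, inverse_edge (panel_gpd wd s) i)]" and ?D = "path_end wd C us"
  have path: "is_path M wd C (us @ ?p @ vs)" "is_path M wd C (us @ [] @ vs)"
    using wd.elementary_homotopy_path[of C _ C] assms unfolding delete_inverse by simp_all
  then have i: "s \<in> gens M" "i \<in> edges (par s)" "ini G i = ?D" "i \<in> edges G"
    by (auto simp: is_path_append)
  have "gal_composite G (?D, ?p) = idn G ?D"
    using i idn_cmp[of i] inverse_edge_par[OF i(1,2)] cmp_inverse_edge[of i]
    by (simp add: gal_composite_def)
  moreover have "path_end wd ?D ?p = ?D"
    using i inverse_edge_par[OF i(1,2)] by simp
  ultimately show ?thesis
    using composite_replace[OF path] delete_inverse by simp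
next
  case (compose C us s i j vs)
  let ?p = "[(s, i), (s, j)]" and ?D = "path_end wd C us"
  have path: "is_path M wd C (us @ ?p @ vs)" "is_path M wd C (us @ [(s, cmp (panel_gpd wd s) i j)] @ vs)"
    using wd.elementary_homotopy_path[of C _ C] assms unfolding compose by blast+
  then have i: "i \<in> edges G" "ini G i = ?D" "j \<in> edges G" "ini G j = ter G i"
    by (auto simp: is_path_append)
  have "gal_composite G (?D, ?p) = gal_composite G (?D, [(s, cmp (panel_gpd wd s) i j)])"
    using i idn_cmp[of i] idn_cmp[of "cmp G i j"] by (simp add: gal_composite_def cmp_closed ini_cmp)
  moreover have "path_end wd ?D ?p = path_end wd ?D [(s, cmp (panel_gpd wd s) i j)]"
    using i by (simp add: ter_cmp)
  ultimately show ?thesis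
    using composite_replace[OF path] compose by simp
next
  case (delete_suite C us xs vs s t)
  let ?D = "path_end wd C us"
  have path: "is_path M wd C (us @ xs @ vs)" "is_path M wd C (us @ [] @ vs)"
    using wd.elementary_homotopy_path[of C _ C] assms unfolding delete_suite by simp_all
  have "gal_composite G (?D, xs) = idn G ?D" "path_end wd ?D xs = ?D"
    using delete_suite(5) by (simp_all add: suites_wd gal_ter_def gal_ini_def st_cycles_def)
  then show ?thesis
    using composite_replace[OF path] delete_suite by simp
qed

lemma composite_homotopy:
  assumes "(\<beta>, \<beta>') \<in> homotopy_rel M wd"
  shows "gal_composite G \<beta> = gal_composite G \<beta>'"
proof -
  have "equivclp (elementary_homotopy M wd) \<beta> \<beta>'"
    using assms by (simp add: homotopy_rel_def)
  then show ?thesis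
    by (induction rule: equivclp_induct) (auto dest: composite_elementary_homotopy)
qed

lemma delta_geodesic:
  assumes "is_path M wd C xs" "reduced M (map fst xs)"
  shows "\<delta> (gal_composite G (C, xs)) = word_elt M (map fst xs)"
  using assms
proof (induction xs rule: rev_induct)
  case Nil
  then show ?case by (simp add: WG1 word_elt_one)
next
  case (snoc x xs)
  obtain s e where x: "x = (s, e)" by (cases x)
  have path: "is_path M wd C xs"
    and e: "s \<in> gens M" "e \<in> edges (par s)" "ini G e = path_end wd C xs" "e \<noteq> idn G (ini G e)"
    using snoc.prems(1) by (auto simp: x is_path_append)
  have red: "reduced M (map fst xs)" "reduced M (map fst xs @ [s])"
    using snoc.prems(2) reduced_appendD(1) by (simp_all add: x)
  have IH: "\<delta> (gal_composite G (C, xs)) = word_elt M (map fst xs)"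
    using snoc.IH path red(1) by blast
  have elt: "word_elt M (map fst xs) \<cdot> gen_elt M s = word_elt M (map fst xs @ [s])"
    using e(1) reduced_words[OF red(1)] by (simp add: word_elt_mult)
  have "\<delta> (cmp G (gal_composite G (C, xs)) e) = \<delta> (gal_composite G (C, xs)) \<cdot> gen_elt M s"
  proof (rule delta_cmp_gen)
    show "cox_length (\<delta> (gal_composite G (C, xs))) <
        cox_length (\<delta> (gal_composite G (C, xs)) \<cdot> gen_elt M s)"
      unfolding IH elt using cox_length_reduced[OF red(1)] cox_length_reduced[OF red(2)] by simp
  qed (use composite_path[OF path] e delta_edge[OF e(1,2)] in simp_all)
  then show ?case
    using IH elt by (simp add: x composite_snoc)
qed

text \<open>The last letter is peeled off: WG3 provides \<open>h\<close> of type \<open>w\<close>,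
  and \<open>h^-1 g\<close> is the final edge of the gallery. Strictness settles the empty
  word.\<close>

lemma path_of_edge:
  assumes "g \<in> edges G" "reduced M w" "\<delta> g = word_elt M w"
  shows "\<exists>xs. is_path M wd (ini G g) xs \<and> map fst xs = w \<and> gal_composite G (ini G g, xs) = g"
  using assms
proof (induction w arbitrary: g rule: rev_induct)
  case Nil
  then have "g = idn G (ini G g)" using strict[of g] word_elt_one by simp
  then show ?case using ini_closed[OF Nil(1)] by (intro exI[of _ "[]"]) simp
next
  case (snoc s w)
  have w: "reduced M w" "w \<in> words" "s \<in> gens M"
    using snoc.prems(2) reduced_appendD(1) reduced_words[OF snoc.prems(2)] by auto
  have "word_elt M (w @ [s]) = word_elt M w \<cdot> gen_elt M s"
    using w by (simp add: word_elt_mult)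
  then have ws: "\<delta> g \<cdot> gen_elt M s = word_elt M w"
    using snoc.prems(3) mult_gen_gen[of "word_elt M w" s] w by (simp add: word_elt_closed)
  have "bruhat_less M (\<delta> g \<cdot> gen_elt M s) (\<delta> g)"
  proof (rule bruhat_lessI[OF range[OF snoc.prems(1)] w(3)])
    show "cox_length (\<delta> g \<cdot> gen_elt M s) < cox_length (\<delta> g)"
      using ws snoc.prems(3) cox_length_reduced[OF w(1)] cox_length_reduced[OF snoc.prems(2)]
      by simp
  qed
  then obtain h where h: "h \<in> edges G" "ini G h = ini G g"
    "\<delta> (cmp G (inverse_edge G h) g) = gen_elt M s" "\<delta> h = word_elt M w"
    using WG3[OF snoc.prems(1) w(3)] ws by auto
  define e where "e = cmp G (inverse_edge G h) g"
  have e: "e \<in> edges G" "ini G e = ter G h" "ter G e = ter G g" "\<delta> e = gen_elt M s" "cmp G h e = g"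
    using h snoc.prems(1) cmp_closed[of "inverse_edge G h" g] ini_cmp[of "inverse_edge G h" g]
      ter_cmp[of "inverse_edge G h" g] cmp_cancel_left'[of h g] by (simp_all add: e_def)
  obtain xs where xs: "is_path M wd (ini G g) xs" "map fst xs = w" "gal_composite G (ini G g, xs) = h"
    using snoc.IH[OF h(1) w(1) h(4)] h(2) by auto
  have "e \<noteq> idn G (ini G e)"
    using e(4) WG1[OF ini_closed[OF e(1)]] gen_elt_neq_one[OF w(3)] by metis
  moreover have "ini G e = path_end wd (ini G g) xs"
    using e(2) composite_path(3)[OF xs(1)] xs(3) by simp
  ultimately have "is_path M wd (ini G g) (xs @ [(s, e)])"
    using xs(1) e w(3) ini_closed[OF e(1)] ter_closed[OF e(1)] by (simp add: is_path_append)
  then show ?case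
    using xs(2,3) e(5) by (intro exI[of _ "xs @ [(s, e)]"]) (simp add: composite_snoc)
qed

lemma composite_surj:
  assumes "g \<in> edges G"
  shows "\<exists>xs. is_path M wd (ini G g) xs \<and> reduced M (map fst xs) \<and> gal_composite G (ini G g, xs) = g"
proof -
  obtain w where "reduced M w" "word_elt M w = \<delta> g"
    using reduced_exists[OF range[OF assms]] .
  then show ?thesis using path_of_edge[OF assms] by fastforce
qed

text \<open>The gallery \<open>xs ys^-1 ys\<close> contracts to \<open>xs\<close> by cancellation,
  and to \<open>ys\<close> once the loop \<open>xs ys^-1\<close> is known to be
  null-homotopic.\<close>

lemma same_composite_loop:
  assumes xs: "is_path M wd C xs" and ys: "is_path M wd C ys"
    and eq: "gal_composite G (C, xs) = gal_composite G (C, ys)"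
  shows "is_path M wd C (xs @ rev_path wd ys @ ys)" "path_end wd C (xs @ rev_path wd ys) = C"
    "gal_composite G (C, xs @ rev_path wd ys) = idn G C"
proof -
  have ends: "path_end wd C xs = path_end wd C ys"
    using composite_path(3)[OF xs] composite_path(3)[OF ys] eq by simp
  show path: "is_path M wd C (xs @ rev_path wd ys @ ys)"
    and loop: "path_end wd C (xs @ rev_path wd ys) = C"
    using xs ys ends wd.is_path_rev_path[OF ys] by (simp_all add: is_path_append path_end_append)
  let ?k = "gal_composite G (C, xs @ rev_path wd ys)" and ?g = "gal_composite G (C, xs)"
  have path': "is_path M wd C (xs @ rev_path wd ys)"
    using path by (simp add: is_path_append)
  \<comment> \<open>No composite of a reversed gallery is computed: homotopy invariance gives
    \<open>k g = g\<close>, and \<open>g\<close> is cancelled.\<close>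
  have "cmp G ?k ?g = ?g"
    using composite_append[of C "xs @ rev_path wd ys" ys] composite_homotopy[OF wd.rev_path_cancel[OF path]]
      path loop eq by simp
  moreover have "ter G ?k = ini G ?g"
    using composite_path(3)[OF path'] composite_path(2)[OF xs] loop by simp
  ultimately show "?k = idn G C"
    using cmp_cancel_right[of ?k ?g] cmp_inverse_edge[of ?g] composite_path[OF path'] composite_path[OF xs]
    by simp
qed


section \<open>The Weyl graph and its fundamental groupoid\<close>

lemma pre_weyl_graph_wd: "pre_weyl_graph M wd"
proof (intro pre_weyl_graph.intro pre_weyl_graph_axioms.intro weyl_data_wd)
  fix s P assume s: "s \<in> gens M" and "P \<in> panels wd s"
  then obtain C where C: "C \<in> verts G" "P = component (par s) C"
    by (auto simp: panels_def)
  obtain e where e: "e \<in> edges G" "ini G e = C" "\<delta> e = gen_elt M s"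
    using weak[OF C(1) s] by blast
  have "idn G C \<in> edges (par s)" "e \<in> edges (par s)"
    using C e by (simp_all add: idn_closed WG1)
  then have in_P: "idn G C \<in> edges P" "e \<in> edges P"
    using C e ini_idn[OF C(1)] ter_idn[OF C(1)] ter_closed[OF e(1)]
    by (auto simp: component_def Let_def)
  have "e \<noteq> idn G C"
    using e(3) WG1[OF C(1)] gen_elt_neq_one[OF s] by metis
  then show "\<not> trivial_groupoid P"
    using in_P by (auto simp: trivial_groupoid_def)
next
  fix s t \<gamma> assume st: "(s, t) \<in> finite_pairs M" and "\<gamma> \<in> max_geodesics M wd s t"
  then obtain C xs where \<gamma>: "\<gamma> = (C, xs)" "is_path M wd C xs"
    "map fst xs = alt_word (the_enat (cox M s t)) s t"
    by (cases \<gamma>) (auto simp: max_geodesics_def galleries_def gal_type_def)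
  obtain m where m: "cox M s t = enat m" and gens: "s \<in> gens M" "t \<in> gens M" "s \<noteq> t"
    using st by (auto simp: finite_pairs_def)
  have ts: "cox M t s = enat m" using cox_sym gens m by simp
  have xs_type: "map fst xs = alt_word m s t" using \<gamma>(3) m by simp
  have red: "reduced M (alt_word m s t)" "reduced M (alt_word m t s)"
    using reduced_alt_word[of s t m] reduced_alt_word[of t s m] gens m ts by auto
  let ?g = "gal_composite G (C, xs)"
  \<comment> \<open>The composite has the value \<open>p(s,t) = p(t,s)\<close>, so it can be split
    again along the second reduced word.\<close>
  have "\<delta> ?g = word_elt M (alt_word m t s)"
    using delta_geodesic[OF \<gamma>(2)] xs_type red(1) alt_word_braid[OF gens(1,2) m] by simp
  then obtain ys where ys: "is_path M wd C ys" "map fst ys = alt_word m t s"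
    "gal_composite G (C, ys) = ?g"
    using path_of_edge[of ?g] red(2) composite_path[OF \<gamma>(2)] by auto
  note loop = same_composite_loop[OF \<gamma>(2) ys(1) ys(3)[symmetric]]
  have "map fst (xs @ rev_path wd ys) = alt_word (2 * m) s t"
    using alt_word_append[of m m s t] xs_type ys(2)
    by (auto simp: map_fst_rev_path rev_alt_word mult_2)
  then have "(C, xs @ rev_path wd ys) \<in> suites wd s t"
    using loop m by (simp add: suites_wd st_cycles_def galleries_def gal_ini_def gal_ter_def
        gal_type_def is_path_append)
  then have "elementary_homotopy M wd (C, [] @ (xs @ rev_path wd ys) @ ys) (C, [] @ ys)"
    using loop(1) st by (intro elementary_homotopy.delete_suite) (simp_all add: galleries_def gal_ter_def)
  from wd.elementary_homotopy_rel[OF this] have "((C, xs @ rev_path wd ys @ ys), (C, ys)) \<in> homotopy_rel M wd"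
    by simp
  then have "(\<gamma>, (C, ys)) \<in> homotopy_rel M wd"
    using homotopy_rel_trans[OF homotopy_rel_sym[OF wd.rev_path_cancel[OF loop(1)]]] \<gamma>(1) by blast
  moreover have "(C, ys) \<in> max_geodesics M wd t s"
    using ys ts by (simp add: max_geodesics_def galleries_def gal_type_def)
  ultimately show "\<exists>\<gamma>'\<in>max_geodesics M wd t s. (\<gamma>, \<gamma>') \<in> homotopy_rel M wd" by blast
qed

interpretation wd: pre_weyl_graph M wd
  by (rule pre_weyl_graph_wd)

lemma W_length_geodesic:
  assumes "\<gamma> \<in> geodesics M wd"
  shows "W_length M \<gamma> = \<delta> (gal_composite G \<gamma>)"
  using assms delta_geodesic[of "fst \<gamma>" "snd \<gamma>"]
  by (simp add: geodesics_def galleries_def W_length_def gal_type_def)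

lemma weyl_graph_wd: "weyl_graph M wd"
proof (intro weyl_graph.intro weyl_graph_axioms.intro pre_weyl_graph_wd)
  fix \<gamma> \<gamma>' assume "\<gamma> \<in> geodesics M wd" "\<gamma>' \<in> geodesics M wd" "(\<gamma>, \<gamma>') \<in> homotopy_rel M wd"
  then show "W_length M \<gamma> = W_length M \<gamma>'"
    using W_length_geodesic[of \<gamma>] W_length_geodesic[of \<gamma>'] composite_homotopy[of \<gamma> \<gamma>'] by simp
qed

lemma same_composite_homotopic:
  assumes xs: "is_path M wd C xs" and ys: "is_path M wd C ys"
    and eq: "gal_composite G (C, xs) = gal_composite G (C, ys)"
  shows "((C, xs), (C, ys)) \<in> homotopy_rel M wd"
proof -
  note loop = same_composite_loop[OF xs ys eq]
  have path: "is_path M wd C (xs @ rev_path wd ys)"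
    using loop(1) by (simp add: is_path_append)
  then obtain zs where zs: "((C, xs @ rev_path wd ys), (C, zs)) \<in> homotopy_rel M wd"
    "reduced M (map fst zs)"
    using wd.homotopic_geodesic[OF coxeter_matrix_axioms] by blast
  have "word_elt M (map fst zs) = \<delta> (gal_composite G (C, zs))"
    using delta_geodesic[of C zs] zs by (simp add: homotopy_rel_def galleries_def)
  also have "\<dots> = word_elt M []"
    using composite_homotopy[OF zs(1)] loop(3) WG1[of C] is_path_ini[OF xs] by (simp add: word_elt_one)
  finally have "zs = []"
    using reduced_length_eq[OF zs(2) reduced_Nil] by simp
  then have "equivclp (elementary_homotopy M wd) (C, xs @ rev_path wd ys) (C, [])"
    using zs(1) by (simp add: homotopy_rel_def)
  \<comment> \<open>Contracting the loop in front of \<open>ys\<close> leaves \<open>ys\<close>;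
    cancelling \<open>ys^-1 ys\<close> instead leaves \<open>xs\<close>.\<close>
  then have "((C, [] @ (xs @ rev_path wd ys) @ ys), (C, [] @ [] @ ys)) \<in> homotopy_rel M wd"
    using wd.homotopy_context[of C "xs @ rev_path wd ys" "(C, [])" C "[]" ys] loop(1) by auto
  then show ?thesis
    using homotopy_rel_trans[OF homotopy_rel_sym[OF wd.rev_path_cancel[OF loop(1)]]] by simp
qed

definition gal_fiber :: "'e \<Rightarrow> ('s, 'v, 'e) gallery set" where
  "gal_fiber g = {\<beta> \<in> galleries M wd. gal_composite G \<beta> = g}"

lemma gal_composite_ends:
  assumes "\<beta> \<in> galleries M wd"
  shows "gal_composite G \<beta> \<in> edges G" "gal_ini \<beta> = ini G (gal_composite G \<beta>)"
    "gal_ter wd \<beta> = ter G (gal_composite G \<beta>)"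
  using assms composite_path[of "fst \<beta>" "snd \<beta>"]
  by (simp_all add: galleries_def gal_ini_def gal_ter_def)

text \<open>Homotopy invariance gives one inclusion and injectivity the other. Operations on classes
  can now be evaluated on any member of a fibre.\<close>

lemma homotopy_class_eq:
  assumes "\<beta> \<in> galleries M wd"
  shows "homotopy_class M wd \<beta> = gal_fiber (gal_composite G \<beta>)"
proof (intro equalityI subsetI)
  fix \<gamma> assume "\<gamma> \<in> homotopy_class M wd \<beta>"
  then have "(\<beta>, \<gamma>) \<in> homotopy_rel M wd" by (simp add: homotopy_class_def)
  then show "\<gamma> \<in> gal_fiber (gal_composite G \<beta>)"
    using composite_homotopy[of \<beta> \<gamma>] by (simp add: gal_fiber_def homotopy_rel_def)
next
  fix \<gamma> assume "\<gamma> \<in> gal_fiber (gal_composite G \<beta>)"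
  then have \<gamma>: "\<gamma> \<in> galleries M wd" "gal_composite G \<gamma> = gal_composite G \<beta>"
    by (simp_all add: gal_fiber_def)
  have "fst \<gamma> = fst \<beta>"
    using gal_composite_ends(2)[OF assms] gal_composite_ends(2)[OF \<gamma>(1)] \<gamma>(2) by (simp add: gal_ini_def)
  then have "(\<beta>, \<gamma>) \<in> homotopy_rel M wd"
    using same_composite_homotopic[of "fst \<beta>" "snd \<beta>" "snd \<gamma>"] assms \<gamma>
    by (cases \<beta>, cases \<gamma>) (simp add: galleries_def)
  then show "\<gamma> \<in> homotopy_class M wd \<beta>" by (simp add: homotopy_class_def)
qed

lemma gal_fiber_geodesic:
  assumes "g \<in> edges G"
  shows "gal_fiber g \<inter> geodesics M wd \<noteq> {}"
proof -
  obtain xs where "is_path M wd (ini G g) xs" "reduced M (map fst xs)" "gal_composite G (ini G g, xs) = g"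
    using composite_surj[OF assms] by blast
  then have "(ini G g, xs) \<in> gal_fiber g \<inter> geodesics M wd"
    by (simp add: gal_fiber_def galleries_def geodesics_def gal_type_def)
  then show ?thesis by blast
qed

lemma the_elem_image_const:
  assumes "A \<noteq> {}" "\<And>x. x \<in> A \<Longrightarrow> f x = c"
  shows "the_elem (f ` A) = c"
proof -
  have "f ` A = {c}" using assms by force
  then show ?thesis by simp
qed

lemma groupoid_iso_gal_fiber: "groupoid_iso G (fundamental_groupoid M wd) id gal_fiber"
proof (rule groupoid_transport)
  let ?F = "fundamental_groupoid M wd"
  show "groupoid G" by (rule groupoid_axioms)
  show "bij_betw id (verts G) (verts ?F)" by (simp add: fundamental_groupoid_def)
  have nonempty: "gal_fiber g \<noteq> {}" if "g \<in> edges G" for g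
    using gal_fiber_geodesic[OF that] by blast
  have "inj_on gal_fiber (edges G)"
  proof (rule inj_onI)
    fix g h assume g: "g \<in> edges G" and eq: "gal_fiber g = gal_fiber h"
    obtain \<beta> where "\<beta> \<in> gal_fiber g" using nonempty[OF g] by blast
    moreover from this eq have "\<beta> \<in> gal_fiber h" by simp
    ultimately show "g = h" by (simp add: gal_fiber_def)
  qed
  moreover have "gal_fiber ` edges G = edges ?F"
  proof (intro equalityI subsetI)
    fix X assume "X \<in> gal_fiber ` edges G"
    then obtain g where g: "g \<in> edges G" "X = gal_fiber g" by blast
    obtain \<beta> where "\<beta> \<in> gal_fiber g" using nonempty[OF g(1)] by blast
    then have "\<beta> \<in> galleries M wd" "X = homotopy_class M wd \<beta>"
      using homotopy_class_eq[of \<beta>] g(2) by (auto simp: gal_fiber_def)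
    then show "X \<in> edges ?F" by (auto simp: fundamental_groupoid_def)
  next
    fix X assume "X \<in> edges ?F"
    then obtain \<beta> where "\<beta> \<in> galleries M wd" "X = homotopy_class M wd \<beta>"
      by (auto simp: fundamental_groupoid_def)
    then show "X \<in> gal_fiber ` edges G"
      using homotopy_class_eq gal_composite_ends(1) by blast
  qed
  ultimately show "bij_betw gal_fiber (edges G) (edges ?F)" by (simp add: bij_betw_def)
  fix g assume g: "g \<in> edges G"
  have mem: "\<beta> \<in> galleries M wd" "gal_composite G \<beta> = g" if "\<beta> \<in> gal_fiber g" for \<beta> g
    using that by (simp_all add: gal_fiber_def)
  have "the_elem (gal_ini ` gal_fiber g) = ini G g"
    by (rule the_elem_image_const[OF nonempty[OF g]]) (use gal_composite_ends(2) mem in auto)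
  then show "ini ?F (gal_fiber g) = id (ini G g)" by (simp add: fundamental_groupoid_def)
  have "the_elem (gal_ter wd ` gal_fiber g) = ter G g"
    by (rule the_elem_image_const[OF nonempty[OF g]]) (use gal_composite_ends(3) mem in auto)
  then show "ter ?F (gal_fiber g) = id (ter G g)" by (simp add: fundamental_groupoid_def)
  fix h assume h: "h \<in> edges G" "ter G g = ini G h"
  \<comment> \<open>The product of classes is a union over pairs of representatives; all its members
    are this one fibre.\<close>
  have "homotopy_class M wd (gal_append \<beta> \<beta>') = gal_fiber (cmp G g h)"
    if "\<beta> \<in> gal_fiber g" "\<beta>' \<in> gal_fiber h" for \<beta> \<beta>'
  proof -
    note \<beta> = mem[OF that(1)] gal_composite_ends[OF mem(1)[OF that(1)]]
    note \<beta>' = mem[OF that(2)] gal_composite_ends[OF mem(1)[OF that(2)]]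
    have adj: "fst \<beta>' = path_end wd (fst \<beta>) (snd \<beta>)"
      using \<beta>(2,5) \<beta>'(2,4) h(2) by (simp add: gal_ini_def gal_ter_def)
    have path: "is_path M wd (fst \<beta>) (snd \<beta> @ snd \<beta>')"
      using \<beta>(1) \<beta>'(1) adj by (simp add: galleries_def is_path_append)
    have "gal_composite G (gal_append \<beta> \<beta>') = cmp G g h"
      using composite_append[OF path] adj[symmetric] \<beta>(2) \<beta>'(2) by (simp add: gal_append_def)
    moreover have "gal_append \<beta> \<beta>' \<in> galleries M wd"
      using path by (simp add: galleries_def gal_append_def)
    ultimately show ?thesis using homotopy_class_eq by simp
  qed
  then show "gal_fiber (cmp G g h) = cmp ?F (gal_fiber g) (gal_fiber h)"
    using nonempty[OF g] nonempty[OF h(1)] by (simp add: fundamental_groupoid_def)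
next
  fix C assume "C \<in> verts G"
  then have "(C, []) \<in> galleries M wd" by (simp add: galleries_def)
  then show "gal_fiber (idn G C) = idn (fundamental_groupoid M wd) (id C)"
    using homotopy_class_eq[of "(C, [])"] by (simp add: fundamental_groupoid_def)
qed

lemma metrization_gal_fiber:
  assumes "g \<in> edges G"
  shows "metrization M wd (gal_fiber g) = \<delta> g"
  unfolding metrization_def
  by (rule the_elem_image_const[OF gal_fiber_geodesic[OF assms]])
    (auto simp: W_length_geodesic gal_fiber_def)

end

theorem proposition5p20:
  fixes M :: "'s coxeter_matrix" and G :: "('v, 'e) groupoid"
    and \<delta> :: "'e \<Rightarrow> 's signed_word set"
  assumes "coxeter_matrix M"
    and "strict_W_groupoid M G \<delta>"
  shows "weyl_graph M (associated_weyl_data M G \<delta>) \<and>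
    (\<exists>\<psi>\<^sub>0 \<psi>. groupoid_iso G (fundamental_groupoid M (associated_weyl_data M G \<delta>)) \<psi>\<^sub>0 \<psi> \<and>
      (\<forall>g \<in> edges G. \<delta> g = metrization M (associated_weyl_data M G \<delta>) (\<psi> g)))"
proof -
  interpret coxeter_W_groupoid M G \<delta>
    using assms by (rule coxeter_W_groupoid.intro)
  show ?thesis
    using weyl_graph_wd groupoid_iso_gal_fiber metrization_gal_fiber by metis
qed

end
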